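(* Let $n\ge 2$, $1<p<\infty$, $0\leq\alpha<n$, and let $\Omega\subset\mathbb{R}^{n}$ be an open set with $|\Omega|<\infty$. Then there is a constant $c_{0}=c_{0}(p,\Omega)$ such that for all $f\in L^{p}(\mathbb{R}^{n})$, $f\neq 0$, with support contained in $\Omega$, $$\int_{\Omega}\frac{\exp\left(\left(1-\frac{\alpha}{n}\right)\frac{n}{\omega_{n-1}}\left|\frac{I_{\gamma}\ast f(x)}{\|f\|_{p}}\right|^{p'}\right)}{|x|^{\alpha}}\,dx\leq c_{0},$$ where $\gamma=n/p$ and $I_{\gamma}\ast f(x)=\int_{\mathbb{R}^n}|x-y|^{\gamma-n}f(y)\,dy$ is the Riesz potential of order $\gamma$.
   Context: $|\Omega|$ is the Lebesgue measure of $\Omega$; $\|\cdot\|_p$ is the $L^p$-norm with respect to Lebesgue measure on $\mathbb{R}^n$; $p'=p/(p-1)$ is the conjugate exponent; $\omega_{n-1}=\frac{2\pi^{n/2}}{\Gamma(n/2)}$ is the surface area of the unit sphere in $\mathbb{R}^n$.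
   Formalization: The constant c_0 is allowed to depend on α as well as on p and Ω; one independent of α is impossible when 0 lies in Ω, because the integral is at least ∫_Ω |x|^{-α} dx, which tends to infinity as α → n. *)

theory Defs
  imports "HOL-Analysis.Analysis"
begin

text \<open>Elements of \<open>L\<^sup>p(\<real>\<^sup>n)\<close>, \<open>p < \<infinity>\<close>, are represented by Lebesgue measurable functions;
  equality in \<open>L\<^sup>p\<close> is equality almost everywhere.\<close>

definition Lp :: "real \<Rightarrow> ('a::euclidean_space \<Rightarrow> real) set" where
  "Lp p = {f. f \<in> borel_measurable lebesgue \<and> integrable lebesgue (\<lambda>x. \<bar>f x\<bar> powr p)}"

definition Lp_norm :: "real \<Rightarrow> ('a::euclidean_space \<Rightarrow> real) \<Rightarrow> real" where
  "Lp_norm p f = (LINT x|lebesgue. \<bar>f x\<bar> powr p) powr (1 / p)"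

text \<open>The support of a function given up to almost everywhere equality: the complement of the
  largest open set on which it vanishes almost everywhere. Unlike the closure of
  \<open>{x. f x \<noteq> 0}\<close>, it does not depend on the representative.\<close>

definition ess_support :: "('a::euclidean_space \<Rightarrow> real) \<Rightarrow> 'a set" where
  "ess_support f = - \<Union>{U. open U \<and> (AE x in lebesgue. x \<in> U \<longrightarrow> f x = 0)}"

text \<open>The kernel is not normalised. Its singularity has value \<open>0\<close> here, since
  \<open>0 powr s = 0\<close>; this concerns the single point \<open>y = x\<close> only. The Bochner integral is \<open>0\<close> at those \<open>x\<close>
  for which the integrand is not integrable; for \<open>0 < \<gamma> < n\<close> and \<open>f \<in> L\<^sup>p\<close>, \<open>p \<ge> 1\<close>, vanishing almost
  everywhere outside a set of finite measure, these \<open>x\<close> form a null set.\<close>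

definition riesz_potential :: "real \<Rightarrow> ('a::euclidean_space \<Rightarrow> real) \<Rightarrow> 'a \<Rightarrow> real" where
  "riesz_potential \<gamma> f x = (LINT y|lebesgue. norm (x - y) powr (\<gamma> - real DIM('a)) * f y)"

text \<open>Surface area of the unit sphere of \<open>\<real>\<^sup>n\<close>, usually written with the dimension \<open>n - 1\<close>
  of the sphere as index; the argument here is \<open>n\<close>.\<close>

definition unit_sphere_area :: "nat \<Rightarrow> real" where
  "unit_sphere_area n = 2 * pi powr (real n / 2) / Gamma (real n / 2)"

end

theory Submission
  imports Defs
begin

text \<open>Let \<open>q = p / (p - 1)\<close>, let \<open>v\<close> be the volume of the unit ball and \<open>d = 1 - \<alpha> / n\<close>, and normalise
  \<open>g = \<bar>f\<bar> / \<parallel>f\<parallel>\<^sub>p\<close>. The kernel \<open>\<bar>x\<bar> powr - (n / q)\<close> has decreasing rearrangement \<open>(v / s) powr (1 / q)\<close>.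
  O'Neil's argument (layer cake in \<open>g\<close>, then the bathtub principle in \<open>x\<close> or in \<open>y\<close>, whichever is
  better) bounds the mean of the potential of \<open>g\<close> over a set of measure at least \<open>t\<close> by an integral of
  the decreasing rearrangement of \<open>g\<close>. Take \<open>t = \<bar>\<Omega>\<bar> exp (- k)\<close> and apply Hoelder's inequality on each
  interval \<open>(\<bar>\<Omega>\<bar> exp (- j - 1), \<bar>\<Omega>\<bar> exp (- j)]\<close>, on which \<open>s powr (- 1 / q)\<close> has \<open>L\<^sup>q\<close>-norm \<open>1\<close>. If \<open>P\<^sub>k\<close> is the
  \<open>p\<close>-th power mass of the rearrangement on \<open>(0, \<bar>\<Omega>\<bar> exp (- k)]\<close>, then the potential exceeds
  \<open>v powr (1 / q) * X\<^sub>k\<close>, where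
  \<open>X\<^sub>k = p * P\<^sub>k powr (1 / p) + (\<Sum>j<k. (P\<^sub>j - P\<^sub>j\<^sub>+\<^sub>1) powr (1 / p))\<close>,
  at most on a set of measure \<open>\<bar>\<Omega>\<bar> exp (- k)\<close>. The weight \<open>\<bar>x\<bar> powr - \<alpha>\<close> gives such a set mass at most
  a multiple of \<open>exp (- d * k)\<close>, so everything reduces to a bound for
  \<open>\<Sum>k. exp (d * (X\<^sub>k powr q - k))\<close>.
  This is a discrete form of a lemma of Adams: \<open>X\<^sub>k powr q\<close> never exceeds \<open>k\<close> by more than a constant, and
  the number of \<open>k\<close> with \<open>k - X\<^sub>k powr q \<le> \<lambda>\<close> grows at most linearly in \<open>\<lambda>\<close>, because near-equality in
  Hoelder's inequality at \<open>k\<close> forces \<open>P\<^sub>k\<close> to be at most a multiple of \<open>1 / k\<close>, which leaves too little mass for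
  near-equality at a much later index.\<close>

section \<open>Hoelder's inequality\<close>

lemma conjugate_exponent:
  fixes p q :: real
  assumes "1 < p" "q = p / (p - 1)"
  shows "1 < q" "1 / q + 1 / p = 1"
proof -
  show "1 < q" using assms by (simp add: less_divide_eq)
  have "1 / q = (p - 1) / p" using assms by simp
  then show "1 / q + 1 / p = 1" using assms by (simp add: diff_divide_distrib)
qed

text \<open>Young's inequality for \<open>F / A powr (1 / q)\<close> and
  \<open>G / B powr (1 / p)\<close>, integrated. \<open>A\<close> and \<open>B\<close> are mere
  upper bounds, so that estimates can be inserted directly; the general measure covers intervals
  and, as counting measure, finite sums.\<close>

lemma nn_integral_Holder:
  fixes F G :: "'a \<Rightarrow> real"
  assumes p: "1 < p" and q: "q = p / (p - 1)"
    and [measurable]: "F \<in> borel_measurable M" "G \<in> borel_measurable M"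
    and nonneg: "\<And>x. 0 \<le> F x" "\<And>x. 0 \<le> G x" "0 \<le> A" "0 \<le> B"
    and A: "(\<integral>\<^sup>+x. ennreal (F x powr q) \<partial>M) \<le> ennreal A"
    and B: "(\<integral>\<^sup>+x. ennreal (G x powr p) \<partial>M) \<le> ennreal B"
  shows "(\<integral>\<^sup>+x. ennreal (F x * G x) \<partial>M) \<le> ennreal (A powr (1 / q) * B powr (1 / p))"
proof -
  have q1: "1 < q" "1 / q + 1 / p = 1" using conjugate_exponent[OF p q] by auto
  \<comment> \<open>If \<open>A = 0\<close> or \<open>B = 0\<close>, the normalisation breaks down,
    but then one factor vanishes almost everywhere.\<close>
  have zero: "(\<integral>\<^sup>+x. ennreal (F x * G x) \<partial>M) = 0"
    if "(\<integral>\<^sup>+x. ennreal (H x powr r) \<partial>M) \<le> 0" "H = F \<or> H = G" for H r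
  proof -
    have "AE x in M. ennreal (H x powr r) = 0"
      using that by (subst nn_integral_0_iff_AE[symmetric]) auto
    then have "AE x in M. ennreal (F x * G x) = 0"
      by eventually_elim (use that(2) in auto)
    then show ?thesis by (subst nn_integral_0_iff_AE) auto
  qed
  show ?thesis
  proof (cases "A = 0 \<or> B = 0")
    case True
    then show ?thesis using zero[of F q] zero[of G p] A B by auto
  next
    case False
    then have pos: "0 < A" "0 < B" using nonneg by auto
    define c where "c = A powr (1 / q) * B powr (1 / p)"
    have c: "0 < c" using pos by (simp add: c_def)
    have "F x * G x \<le> (c / (q * A)) * F x powr q + (c / (p * B)) * G x powr p" for x
    proof -
      have "(F x / A powr (1/q)) * (G x / B powr (1/p)) \<le>
          (F x / A powr (1/q)) powr q / q + (G x / B powr (1/p)) powr p / p"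
        using nonneg p q1 by (intro Youngs_inequality) (auto simp: add.commute)
      also have "\<dots> = F x powr q / (q * A) + G x powr p / (p * B)"
        using pos nonneg p q1 by (simp add: powr_divide powr_powr mult.commute)
      finally have "F x * G x / c \<le> F x powr q / (q * A) + G x powr p / (p * B)"
        by (simp add: c_def)
      then show ?thesis using c by (simp add: field_simps)
    qed
    then have "(\<integral>\<^sup>+x. ennreal (F x * G x) \<partial>M) \<le>
       (\<integral>\<^sup>+x. ennreal ((c / (q * A)) * F x powr q + (c / (p * B)) * G x powr p) \<partial>M)"
      by (intro nn_integral_mono ennreal_leI)
    also have "\<dots> = (\<integral>\<^sup>+x. ennreal (c / (q * A)) * ennreal (F x powr q) + ennreal (c / (p * B)) * ennreal (G x powr p) \<partial>M)"
      using c pos p q1 by (intro nn_integral_cong) (simp add: ennreal_mult'[symmetric] ennreal_plus[symmetric] del: ennreal_plus)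
    also have "\<dots> = ennreal (c / (q * A)) * (\<integral>\<^sup>+x. ennreal (F x powr q) \<partial>M) + ennreal (c / (p * B)) * (\<integral>\<^sup>+x. ennreal (G x powr p) \<partial>M)"
      by (simp add: nn_integral_add nn_integral_cmult)
    also have "\<dots> \<le> ennreal (c / (q * A)) * ennreal A + ennreal (c / (p * B)) * ennreal B"
      using A B by (intro add_mono mult_left_mono) auto
    also have "\<dots> = ennreal (c / q + c / p)"
      using c pos p q1 by (simp add: ennreal_mult'[symmetric] ennreal_plus[symmetric] del: ennreal_plus)
    also have "c / q + c / p = c" using q1 c by (metis distrib_left mult.right_neutral times_divide_eq_right)
    finally show ?thesis by (simp add: c_def)
  qed
qed

lemma sum_Holder:
  fixes F G :: "'a \<Rightarrow> real"
  assumes p: "1 < p" and q: "q = p / (p - 1)" and fin: "finite I"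
    and nonneg: "\<And>i. i \<in> I \<Longrightarrow> 0 \<le> F i" "\<And>i. i \<in> I \<Longrightarrow> 0 \<le> G i"
  shows "(\<Sum>i\<in>I. F i * G i) \<le> (\<Sum>i\<in>I. F i powr q) powr (1 / q) * (\<Sum>i\<in>I. G i powr p) powr (1 / p)"
proof -
  have *: "(\<integral>\<^sup>+x. ennreal (h x) \<partial>count_space I) = ennreal (\<Sum>i\<in>I. h i)"
    if "\<And>i. i \<in> I \<Longrightarrow> 0 \<le> h i" for h
    using fin that by (simp add: nn_integral_count_space_finite)
  \<comment> \<open>Nonnegativity is known on \<open>I\<close> only, while the integral version asks
    for it everywhere; hence the truncation by \<open>max 0\<close>.\<close>
  have eq: "(\<Sum>i\<in>I. max 0 (F i) powr q) = (\<Sum>i\<in>I. F i powr q)"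
    "(\<Sum>i\<in>I. max 0 (G i) powr p) = (\<Sum>i\<in>I. G i powr p)"
    "(\<Sum>i\<in>I. max 0 (F i) * max 0 (G i)) = (\<Sum>i\<in>I. F i * G i)"
    using nonneg by (auto intro!: sum.cong simp: max_def)
  have "(\<integral>\<^sup>+x. ennreal (max 0 (F x) * max 0 (G x)) \<partial>count_space I) \<le>
     ennreal ((\<Sum>i\<in>I. F i powr q) powr (1 / q) * (\<Sum>i\<in>I. G i powr p) powr (1 / p))"
    by (rule nn_integral_Holder[OF p q]) (auto simp: * eq intro: sum_nonneg)
  then show ?thesis by (simp add: * eq sum_nonneg)
qed

section \<open>A discrete form of Adams' lemma\<close>

lemma adams_tail_bound:
  fixes p :: real
  assumes p: "1 < p" and q: "q = p / (p - 1)" and P: "0 \<le> P" "P \<le> 1" and lam: "0 \<le> lam" and k: "0 \<le> k"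
    and x: "x \<le> p * P powr (1 / p) + k powr (1 / q) * (1 - P) powr (1 / p)" "0 \<le> x"
    and F: "k - lam \<le> x powr q"
  shows "k * P \<le> (1 + 2 * p + (2 * p\<^sup>2) powr q) * (1 + lam)"
proof (cases "k \<le> lam")
  case True
  have "k * P \<le> lam * 1" using True P k by (intro mult_mono) auto
  also have "\<dots> \<le> 1 * (1 + lam)" by simp
  also have "\<dots> \<le> (1 + 2 * p + (2 * p\<^sup>2) powr q) * (1 + lam)"
    using p lam by (intro mult_right_mono) auto
  finally show ?thesis .
next
  case False
  then have k0: "0 < k" "lam < k" using lam by auto
  have q1: "1 < q" "1 / q + 1 / p = 1" using conjugate_exponent[OF p q] by auto
  define a where "a = P powr (1 / p)"
  define z where "z = k powr (1 / p) * a"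
  have z0: "0 \<le> z" by (simp add: z_def a_def)
  have zp: "z powr p = k * P" using p P k0 by (simp add: z_def a_def powr_mult powr_powr)
  \<comment> \<open>Bernoulli's inequality for exponents at most 1, from the weighted
    arithmetic-geometric mean inequality for \<open>1 - t\<close> and \<open>1\<close>.\<close>
  have bern: "(1 - t) powr r \<le> 1 - r * t" if "0 \<le> t" "t \<le> 1" "0 < r" "r \<le> 1" for t r :: real
  proof (cases "t = 1")
    case False
    have "((1 - t) powr r) * (1 powr (1 - r)) \<le> r * (1 - t) + (1 - r) * 1"
      using False that Youngs_inequality_0[of r "1 - r" "1 - t" 1] by auto
    then show ?thesis by (simp add: algebra_simps)
  qed (use that in auto)
  have "k - lam \<le> x powr q" by fact
  then have "(k - lam) powr (1 / q) \<le> (x powr q) powr (1 / q)"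
    using k0 q1 by (intro powr_mono2) auto
  also have "\<dots> = x" using q1 x by (simp add: powr_powr)
  also have "x \<le> p * a + k powr (1 / q) * (1 - P) powr (1 / p)" using x by (simp add: a_def)
  also have "\<dots> \<le> p * a + k powr (1 / q) * (1 - (1 / p) * P)"
    using bern[of P "1 / p"] P p by (intro add_left_mono mult_left_mono) auto
  finally have up: "(k - lam) powr (1 / q) \<le> p * a + k powr (1 / q) * (1 - (1 / p) * P)" .
  have low: "k powr (1 / q) * (1 - lam / k) \<le> (k - lam) powr (1 / q)"
  proof -
    have "1 - lam / k = (1 - lam / k) powr 1" using k0 lam by simp
    also have "\<dots> \<le> (1 - lam / k) powr (1 / q)"
      using k0 lam q1 by (intro powr_mono') auto
    finally have "k powr (1 / q) * (1 - lam / k) \<le> k powr (1 / q) * (1 - lam / k) powr (1 / q)"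
      by (intro mult_left_mono) auto
    also have "\<dots> = (k * (1 - lam / k)) powr (1 / q)" using k0 lam by (subst powr_mult) auto
    also have "k * (1 - lam / k) = k - lam" using k0 by (simp add: field_simps)
    finally show ?thesis .
  qed
  from low up have "k powr (1 / q) * (P / p - lam / k) \<le> p * a" by (simp add: algebra_simps)
  then have "k powr (1 / p) * (k powr (1 / q) * (P / p - lam / k)) \<le> k powr (1 / p) * (p * a)"
    by (intro mult_left_mono) auto
  also have "k powr (1 / p) * (k powr (1 / q) * (P / p - lam / k)) = k powr (1/q + 1/p) * (P / p - lam / k)"
    by (simp add: powr_add)
  also have "\<dots> = k * P / p - lam" using k0 q1 by (simp add: field_simps)
  finally have "k * P / p - lam \<le> p * z" by (simp add: z_def mult.left_commute)
  then have main: "z powr p \<le> p\<^sup>2 * z + p * lam" using p zp by (simp add: field_simps power2_eq_square)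
  \<comment> \<open>Either the linear term in \<open>main\<close> is at most half of
    \<open>z powr p\<close> and is absorbed, or \<open>z powr (p - 1)\<close> is at most
    \<open>2 * p\<^sup>2\<close>.\<close>
  have "z powr p \<le> 2 * p * lam + (2 * p\<^sup>2) powr q"
  proof (cases "2 * p\<^sup>2 * z \<le> z powr p")
    case True
    then have "z powr p \<le> 2 * p * lam" using main by simp
    then show ?thesis by (simp add: add_increasing2)
  next
    case f: False
    then have z: "0 < z" using z0 by (cases "z = 0") auto
    have "z * z powr (p - 1) < z * (2 * p\<^sup>2)" using f z by (simp add: powr_diff mult.commute)
    then have "z powr (p - 1) \<le> 2 * p\<^sup>2" using z by simp
    then have "(z powr (p - 1)) powr q \<le> (2 * p\<^sup>2) powr q" using q1 by (intro powr_mono2) auto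
    moreover have "(p - 1) * q = p" using p q by simp
    ultimately show ?thesis using p lam by (simp add: powr_powr add_increasing)
  qed
  also have "\<dots> \<le> (1 + 2 * p + (2 * p\<^sup>2) powr q) * (1 + lam)"
    using p lam by (simp add: algebra_simps)
  finally show ?thesis by (simp add: zp)
qed

text \<open>Convexity between 1 and 2 for \<open>s \<le> 1\<close>, and
  \<open>1 + s \<le> 2 * s\<close> otherwise. The excess over 1 must be of first order in
  \<open>s\<close>, since it is going to be multiplied by the large number \<open>k\<close>.\<close>

lemma powr_one_plus_le:
  fixes s q :: real
  assumes "1 \<le> q" "0 \<le> s"
  shows "(1 + s) powr q \<le> 1 + 2 powr q * (s + s powr q)"
proof (cases "s \<le> 1")
  case True
  have "convex_on {0<..} (\<lambda>x::real. x powr q)"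
    using assms by (auto intro: convex_on_subset[OF powr_convex])
  then have "((1 - s) *\<^sub>R 1 + s *\<^sub>R 2) powr q \<le> (1 - s) * 1 powr q + s * 2 powr q"
    using True assms by (intro convex_onD) auto
  then have "(1 + s) powr q \<le> 1 + 2 powr q * s" using assms by (simp add: algebra_simps)
  also have "\<dots> \<le> 1 + 2 powr q * (s + s powr q)" by simp
  finally show ?thesis .
next
  case False
  then have "(1 + s) powr q \<le> (2 * s) powr q" using assms by (intro powr_mono2) auto
  also have "\<dots> = 2 powr q * s powr q" using False by (simp add: powr_mult)
  also have "\<dots> \<le> 1 + 2 powr q * (s + s powr q)" using assms by (simp add: algebra_simps)
  finally show ?thesis .
qed

text \<open>Here \<open>x\<close> belongs to the index \<open>k + D\<close>, where near-equality is
  assumed again. Expanding its \<open>q\<close>-th power around \<open>k\<close> leaves a cross term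
  of order \<open>D powr (1 / q) * (k * P) powr (1 / p)\<close>, sublinear in \<open>D\<close>, and
  a term of order \<open>D * P powr (q - 1)\<close>, which \<open>P \<le> C / K\<close> makes at
  most \<open>D / 4\<close>. Together they cannot reach \<open>D - lam\<close> unless
  \<open>D\<close> is at most a multiple of \<open>1 + lam\<close>.\<close>

lemma adams_gap_bound:
  fixes p :: real
  assumes p: "1 < p" and q: "q = p / (p - 1)" and P: "0 \<le> P" and lam: "0 \<le> lam" and D: "1 \<le> D"
    and K: "0 < K" "0 < C" "2 powr q * (p + 1) powr q * (C / K) powr (q - 1) \<le> 1 / 4"
    and k: "K * (1 + lam) \<le> k" "k * P \<le> C * (1 + lam)"
    and x: "x \<le> (p + D powr (1 / q)) * P powr (1 / p) + k powr (1 / q)" "0 \<le> x"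
    and F: "k + D - lam \<le> x powr q"
  shows "D \<le> (2 + (4 * (2 powr q * (p + 1))) powr p * C) * (1 + lam)"
proof -
  note q1 = conjugate_exponent[OF p q]
  have qp: "q / p = q - 1" "1 - 1 / p = 1 / q" using p q1 by (auto simp: field_simps)
  have k0: "0 < k" using K k lam by (smt (verit) mult_pos_pos)
  define A where "A = 2 powr q"
  define z where "z = (k * P) powr (1 / p)"
  define s where "s = (p + 1) * D powr (1 / q) * z / k"
  have s0: "0 \<le> s" using p k0 by (simp add: s_def z_def)
  have D1: "1 \<le> D powr (1 / q)" using D q1 by (intro ge_one_powr_ge_zero) auto
  have zP: "k powr (1 / q) * (z / k) = P powr (1 / p)"
  proof -
    have "k powr (1 / q) * (z / k) = P powr (1 / p) * (k powr (1 / q + 1 / p) / k)"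
      using k0 P by (simp add: z_def powr_mult powr_add)
    then show ?thesis using q1 k0 by simp
  qed
  have "x \<le> k powr (1 / q) * (1 + s)"
  proof -
    have "(p + D powr (1 / q)) * P powr (1 / p) \<le> ((p + 1) * D powr (1 / q)) * P powr (1 / p)"
      using p D1 by (intro mult_right_mono) (auto simp: algebra_simps)
    also have "\<dots> = k powr (1 / q) * s" by (simp add: s_def zP[symmetric])
    finally show ?thesis using x by (simp add: algebra_simps)
  qed
  then have "x powr q \<le> (k powr (1 / q) * (1 + s)) powr q" using x q1 by (intro powr_mono2) auto
  also have "\<dots> = k * (1 + s) powr q" using k0 q1 s0 by (simp add: powr_mult powr_powr)
  also have "\<dots> \<le> k * (1 + A * (s + s powr q))"
    using powr_one_plus_le[of q s] q1 s0 k0 by (simp add: A_def)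
  finally have xk: "x powr q \<le> k + A * (k * s) + A * (k * s powr q)" by (simp add: algebra_simps)
  have ks: "k * s = (p + 1) * D powr (1 / q) * z" using k0 by (simp add: s_def)
  have ksq: "k * s powr q = (p + 1) powr q * D * P powr (q - 1)"
  proof -
    have "s powr q = (p + 1) powr q * D * (k * P) powr (q / p) / k powr q"
      using p D k0 P q1 by (simp add: s_def z_def powr_mult powr_divide powr_powr)
    then show ?thesis using k0 P unfolding qp
      by (simp add: powr_mult powr_diff)
  qed
  have "P \<le> C / K"
  proof -
    have "P \<le> C * (1 + lam) / k" using k k0 by (simp add: field_simps)
    also have "\<dots> \<le> C * (1 + lam) / (K * (1 + lam))"
      using k k0 K lam by (intro divide_left_mono mult_pos_pos) auto
    also have "\<dots> = C / K" using lam by simp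
    finally show ?thesis .
  qed
  then have "P powr (q - 1) \<le> (C / K) powr (q - 1)" using P q1 by (intro powr_mono2) auto
  then have "A * (p + 1) powr q * P powr (q - 1) \<le> A * (p + 1) powr q * (C / K) powr (q - 1)"
    by (intro mult_left_mono) (auto simp: A_def)
  also have "\<dots> \<le> 1 / 4" using K(3) by (simp only: A_def)
  finally have "D * (A * (p + 1) powr q * P powr (q - 1)) \<le> D * (1 / 4)"
    using D by (intro mult_left_mono) auto
  then have quarter: "A * (k * s powr q) \<le> D / 4" by (simp add: ksq mult_ac)
  have main: "D - lam \<le> A * (p + 1) * z * D powr (1 / q) + D / 4"
    using F xk quarter by (simp add: ks mult_ac)
  \<comment> \<open>If the cross term is at most \<open>D / 4\<close>, then
    \<open>D \<le> 2 * lam\<close>; otherwise \<open>D powr (1 / p)\<close> is less than a multiple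
    of \<open>z\<close>.\<close>
  show ?thesis
  proof (cases "4 * (A * (p + 1)) * z \<le> D powr (1 / p)")
    case True
    then have "4 * (A * (p + 1)) * z * D powr (1 / q) \<le> D powr (1 / p) * D powr (1 / q)"
      by (intro mult_right_mono) auto
    also have "\<dots> = D" using q1 D by (simp add: powr_add[symmetric] add.commute)
    finally have "D \<le> 2 * lam" using main by simp
    also have "\<dots> \<le> (2 + (4 * (2 powr q * (p + 1))) powr p * C) * (1 + lam)"
      using lam K by (simp add: algebra_simps add_increasing)
    finally show ?thesis .
  next
    case False
    then have "(D powr (1 / p)) powr p \<le> (4 * (A * (p + 1)) * z) powr p"
      using p by (intro powr_mono2) auto
    then have "D \<le> (4 * (A * (p + 1))) powr p * (k * P)"
      using p D k0 P by (simp add: powr_powr powr_mult z_def A_def)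
    also have "\<dots> \<le> (4 * (A * (p + 1))) powr p * (C * (1 + lam))"
      using k by (intro mult_left_mono) auto
    also have "\<dots> \<le> (2 + (4 * (2 powr q * (p + 1))) powr p * C) * (1 + lam)"
      using lam by (simp add: algebra_simps A_def)
    finally show ?thesis .
  qed
qed

section \<open>The quantity \<open>X\<^sub>k\<close> for an arbitrary decreasing sequence of
  masses\<close>

definition adams_bound :: "real \<Rightarrow> (nat \<Rightarrow> real) \<Rightarrow> nat \<Rightarrow> real" where
  "adams_bound p P k = p * P k powr (1 / p) + (\<Sum>j<k. (P j - P (Suc j)) powr (1 / p))"

lemma adams_bound_nonneg: "0 \<le> p \<Longrightarrow> 0 \<le> adams_bound p P k"
  by (auto simp: adams_bound_def intro!: add_nonneg_nonneg sum_nonneg)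

text \<open>Hoelder's inequality against the constant 1; the decrements telescope.\<close>

lemma sum_powr_decrement_le:
  fixes P :: "nat \<Rightarrow> real"
  assumes p: "1 < p" and q: "q = p / (p - 1)" and P: "decseq P" and "k \<le> l"
  shows "(\<Sum>j=k..<l. (P j - P (Suc j)) powr (1 / p)) \<le> real (l - k) powr (1 / q) * (P k - P l) powr (1 / p)"
proof -
  have pos: "P (Suc j) \<le> P j" for j using P by (simp add: decseq_Suc_iff)
  have "(\<Sum>j=k..<l. P j - P (Suc j)) = P k - P l"
    using sum_Suc_diff'[OF \<open>k \<le> l\<close>, of "\<lambda>j. - P j"] by simp
  moreover have "(\<Sum>j=k..<l. 1 * (P j - P (Suc j)) powr (1 / p)) \<le>
      (\<Sum>j=k..<l. 1 powr q) powr (1 / q) * (\<Sum>j=k..<l. ((P j - P (Suc j)) powr (1 / p)) powr p) powr (1 / p)"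
    by (intro sum_Holder[OF p q]) auto
  ultimately show ?thesis using p pos by (simp add: powr_powr)
qed

context
  fixes p q :: real and P :: "nat \<Rightarrow> real"
  assumes p: "1 < p" and q: "q = p / (p - 1)"
    and P: "decseq P" "\<And>k. 0 \<le> P k" "P 0 \<le> 1"
begin

lemma decr: "0 \<le> P 0 - P k" "P 0 - P k \<le> 1" "P 0 - P k \<le> 1 - P k" "0 \<le> 1 - P k"
  using P(2)[of k] P(3) decseqD[OF P(1), of 0 k] by linarith+

lemma adams_bound_le:
  "adams_bound p P k \<le> p * P k powr (1 / p) + real k powr (1 / q) * (1 - P k) powr (1 / p)"
proof -
  have "(\<Sum>j<k. (P j - P (Suc j)) powr (1 / p)) \<le> real k powr (1 / q) * (P 0 - P k) powr (1 / p)"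
    using sum_powr_decrement_le[OF p q P(1), of 0 k] by (simp add: atLeast0LessThan)
  also have "\<dots> \<le> real k powr (1 / q) * (1 - P k) powr (1 / p)"
    using decr p by (intro mult_left_mono powr_mono2) auto
  finally show ?thesis by (simp add: adams_bound_def)
qed

lemma adams_bound_powr_le: "adams_bound p P k powr q \<le> real k + p powr q"
proof -
  note q1 = conjugate_exponent[OF p q]
  have Pk: "P k \<le> 1" using P decseqD[OF P(1), of 0 k] by simp
  \<comment> \<open>A two-term sum, indexed by \<open>bool\<close> for Hoelder's inequality; the
    second vector has \<open>p\<close>-norm 1.\<close>
  have "p * P k powr (1 / p) + real k powr (1 / q) * (1 - P k) powr (1 / p) =
     (\<Sum>b\<in>UNIV. (if b then p else real k powr (1 / q)) * (if b then P k powr (1 / p) else (1 - P k) powr (1 / p)))"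
    by (simp add: UNIV_bool)
  also have "\<dots> \<le> (\<Sum>b\<in>UNIV. (if b then p else real k powr (1 / q)) powr q) powr (1 / q) *
     (\<Sum>b\<in>UNIV. (if b then P k powr (1 / p) else (1 - P k) powr (1 / p)) powr p) powr (1 / p)"
    using p by (intro sum_Holder[OF p q]) auto
  also have "\<dots> = (real k + p powr q) powr (1 / q)"
    using p q1 P Pk by (simp add: UNIV_bool powr_powr)
  finally have "adams_bound p P k \<le> (real k + p powr q) powr (1 / q)"
    using adams_bound_le[of k] by simp
  then have "adams_bound p P k powr q \<le> ((real k + p powr q) powr (1 / q)) powr q"
    using p q1 adams_bound_nonneg[of p P k] by (intro powr_mono2) auto
  then show ?thesis using q1 by (simp add: powr_powr)
qed

text \<open>The decrements before \<open>k\<close> have total mass at most 1, and those after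
  \<open>k\<close> share only the mass \<open>P k\<close>. This is the hypothesis on
  \<open>x\<close> in the gap bound, with \<open>D = l - k\<close>.\<close>

lemma adams_bound_later_le:
  assumes "k \<le> l"
  shows "adams_bound p P l \<le> (p + real (l - k) powr (1 / q)) * P k powr (1 / p) + real k powr (1 / q)"
proof -
  have Pl: "0 \<le> P l" "P l \<le> P k" using P decseqD[OF P(1) assms] by auto
  have "(\<Sum>j<l. (P j - P (Suc j)) powr (1 / p)) =
      (\<Sum>j<k. (P j - P (Suc j)) powr (1 / p)) + (\<Sum>j=k..<l. (P j - P (Suc j)) powr (1 / p))"
    using assms by (simp add: lessThan_atLeast0 sum.atLeastLessThan_concat)
  also have "(\<Sum>j=k..<l. (P j - P (Suc j)) powr (1 / p)) \<le> real (l - k) powr (1 / q) * P k powr (1 / p)"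
    using p Pl by (intro order.trans[OF sum_powr_decrement_le[OF p q P(1) assms]] mult_left_mono powr_mono2) auto
  also have "(\<Sum>j<k. (P j - P (Suc j)) powr (1 / p)) \<le> real k powr (1 / q) * (P 0 - P k) powr (1 / p)"
    using sum_powr_decrement_le[OF p q P(1), of 0 k] by (simp add: atLeast0LessThan)
  also have "\<dots> \<le> real k powr (1 / q) * 1 powr (1 / p)"
    using decr p by (intro mult_left_mono powr_mono2) auto
  finally have "(\<Sum>j<l. (P j - P (Suc j)) powr (1 / p)) \<le>
      real k powr (1 / q) + real (l - k) powr (1 / q) * P k powr (1 / p)" by simp
  moreover have "p * P l powr (1 / p) \<le> p * P k powr (1 / p)"
    using p Pl by (intro mult_left_mono powr_mono2) auto
  ultimately show ?thesis by (simp add: adams_bound_def algebra_simps)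
qed

end

text \<open>Below \<open>K * (1 + lam)\<close> there are few enough indices. For the first index
  \<open>m\<close> of the level set beyond that, the tail bound controls \<open>m * P m\<close>, and
  the gap bound then keeps all later ones within a multiple of \<open>1 + lam\<close> of
  \<open>m\<close>. The constant is uniform in \<open>P\<close>.\<close>

lemma adams_level_set_card:
  fixes p :: real
  assumes p: "1 < p" and q: "q = p / (p - 1)"
  obtains C :: real where "0 \<le> C"
    "\<And>P lam. decseq P \<Longrightarrow> (\<And>k. 0 \<le> P k) \<Longrightarrow> P 0 \<le> 1 \<Longrightarrow> 0 \<le> lam \<Longrightarrow>
        finite {k. real k - adams_bound p P k powr q \<le> lam} \<and>
        real (card {k. real k - adams_bound p P k powr q \<le> lam}) \<le> C * (1 + lam)"
proof -
  note q1 = conjugate_exponent[OF p q]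
  define C1 where "C1 = 1 + 2 * p + (2 * p\<^sup>2) powr q"
  have C1: "0 < C1" using p by (simp add: C1_def add_pos_nonneg)
  define B where "B = 2 powr q * (p + 1) powr q"
  have B: "0 < B" using p by (simp add: B_def)
  \<comment> \<open>Solves \<open>B * (C1 / K) powr (q - 1) = 1 / 4\<close>, the smallness that the
    gap bound asks for.\<close>
  define K where "K = C1 * (4 * B) powr (1 / (q - 1))"
  have K: "0 < K" using C1 B by (simp add: K_def)
  have "(C1 / K) powr (q - 1) = 1 / ((4 * B) powr (1 / (q - 1))) powr (q - 1)"
    using C1 B by (simp add: K_def powr_divide)
  also have "\<dots> = 1 / (4 * B)" using q1 B by (simp add: powr_powr)
  finally have KB: "B * (C1 / K) powr (q - 1) \<le> 1 / 4" using B by simp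
  define C4 where "C4 = 2 + (4 * (2 powr q * (p + 1))) powr p * C1"
  have C4: "0 < C4" using C1 by (simp add: C4_def add_pos_nonneg)
  show ?thesis
  proof (rule that[of "K + C4 + 2"])
    show "0 \<le> K + C4 + 2" using K C4 by simp
  next
    fix P lam assume P: "decseq P" "\<And>k. 0 \<le> P k" "P 0 \<le> (1 :: real)" and lam: "0 \<le> (lam :: real)"
    define E where "E = {k. real k - adams_bound p P k powr q \<le> lam}"
    define E' where "E' = {k \<in> E. K * (1 + lam) \<le> real k}"
    define N where "N = nat \<lfloor>K * (1 + lam)\<rfloor>"
    define M where "M = nat \<lfloor>C4 * (1 + lam)\<rfloor>"
    have "\<exists>m. E' \<subseteq> {m..m + M}"
    proof (cases "E' = {}")
      case False
      define m where "m = (LEAST k. k \<in> E')"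
      have m: "m \<in> E'" unfolding m_def using False by (metis LeastI ex_in_conv)
      have "l \<le> m + M" if l: "l \<in> E'" "m < l" for l
      proof -
        have "real m * P m \<le> C1 * (1 + lam)"
          unfolding C1_def
          using m P lam p adams_bound_le[OF p q P] adams_bound_nonneg[of p P m] decseqD[OF P(1), of 0 m]
          by (intro adams_tail_bound[OF p q, where x = "adams_bound p P m"]) (auto simp: E'_def E_def)
        then have "real (l - m) \<le> C4 * (1 + lam)"
          unfolding C4_def
          using m l P lam p K C1 KB adams_bound_later_le[OF p q P, of m l] adams_bound_nonneg[of p P l]
          by (intro adams_gap_bound[OF p q, where x = "adams_bound p P l" and k = "real m" and K = K and P = "P m"])
             (auto simp: E'_def E_def B_def)
        then have "l - m \<le> M" unfolding M_def by (simp add: le_nat_floor)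
        then show ?thesis by simp
      qed
      moreover have "m \<le> l" if "l \<in> E'" for l unfolding m_def using that by (rule Least_le)
      ultimately show ?thesis by (intro exI[of _ m]) (force simp: le_less)
    qed auto
    then obtain m where m: "E' \<subseteq> {m..m + M}" by blast
    have "E \<subseteq> {..N} \<union> {m..m + M}"
    proof
      fix k assume k: "k \<in> E"
      show "k \<in> {..N} \<union> {m..m + M}"
      proof (cases "K * (1 + lam) \<le> real k")
        case True
        then show ?thesis using k m by (auto simp: E'_def)
      next
        case False
        then show ?thesis by (simp add: N_def le_nat_floor)
      qed
    qed
    then have fin: "finite E" and "card E \<le> card ({..N} \<union> {m..m + M})"
      by (auto intro: finite_subset card_mono)
    then have "card E \<le> card {..N} + card {m..m + M}" using card_Un_le order.trans by blast
    \<comment> \<open>The two intervals have \<open>N + 1\<close> and \<open>M + 1\<close>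
      elements.\<close>
    then have "real (card E) \<le> real N + real M + 2" by simp
    also have "real N \<le> K * (1 + lam)" using K lam by (simp add: N_def)
    also have "real M \<le> C4 * (1 + lam)" using C4 lam by (simp add: M_def)
    finally have "real (card E) \<le> (K + C4 + 2) * (1 + lam)" using lam by (simp add: algebra_simps)
    with fin show "finite {k. real k - adams_bound p P k powr q \<le> lam} \<and>
        real (card {k. real k - adams_bound p P k powr q \<le> lam}) \<le> (K + C4 + 2) * (1 + lam)"
      by (simp add: E_def)
  qed
qed

lemma summable_linear_times_exp:
  fixes d :: real
  assumes "0 < d"
  shows "summable (\<lambda>j. (1 + real j) * exp (- (d * real j)))"
proof -
  define r where "r = exp (- d)"
  have r: "norm r < 1" using assms by (simp add: r_def)
  have "summable (\<lambda>j. real (Suc j) * 1 * r ^ j)"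
    using r termdiff_converges_all[of "\<lambda>_. 1" r] termdiff_converges[of r 1 "\<lambda>_. 1"]
    by (auto simp: diffs_def intro!: summable_geometric)
  then show ?thesis by (simp add: r_def exp_of_nat_mult[symmetric] mult.commute)
qed

lemma ennreal_le_suminf: "f j \<le> (\<Sum>j. f j)" for f :: "nat \<Rightarrow> ennreal"
  using sum_le_suminf[of f "{j}"] by simp

text \<open>The indices are sorted by the deficit \<open>F k\<close>, rounded up to a natural number
  \<open>j\<close>. At most a multiple of \<open>1 + j\<close> indices meet the weight
  \<open>exp (- (d * j))\<close>, which leaves a convergent series.\<close>

lemma adams_discrete:
  fixes p d :: real
  assumes p: "1 < p" and q: "q = p / (p - 1)" and d: "0 < d"
  obtains C :: real where
    "\<And>P. decseq P \<Longrightarrow> (\<And>k. 0 \<le> P k) \<Longrightarrow> P 0 \<le> 1 \<Longrightarrow>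
        (\<Sum>k. ennreal (exp (d * (adams_bound p P k powr q - real k)))) \<le> ennreal C"
proof -
  obtain C where C: "0 \<le> C"
    "\<And>P lam. decseq P \<Longrightarrow> (\<And>k. 0 \<le> P k) \<Longrightarrow> P 0 \<le> 1 \<Longrightarrow> 0 \<le> lam \<Longrightarrow>
        finite {k. real k - adams_bound p P k powr q \<le> lam} \<and>
        real (card {k. real k - adams_bound p P k powr q \<le> lam}) \<le> C * (1 + lam)"
    using adams_level_set_card[OF p q] by blast
  \<comment> \<open>Pays for replacing \<open>F k\<close> by \<open>j\<close>: rounding up adds less
    than 1, and a negative deficit, which is at least \<open>- (p powr q)\<close>, goes to
    \<open>j = 0\<close>.\<close>
  define c where "c = exp (d * (1 + p powr q))"
  have c: "0 \<le> c" by (simp add: c_def)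
  show ?thesis
  proof (rule that[of "\<Sum>j. c * C * ((1 + real j) * exp (- (d * real j)))"])
    fix P assume P: "decseq P" "\<And>k. 0 \<le> P k" "P 0 \<le> (1 :: real)"
    define F where "F k = real k - adams_bound p P k powr q" for k
    have bound: "ennreal (exp (- (d * F k))) \<le>
        (\<Sum>j. ennreal (c * exp (- (d * real j))) * indicator {k. F k \<le> real j} k)" for k
    proof -
      define j where "j = nat \<lceil>F k\<rceil>"
      have j: "F k \<le> real j" by (simp add: j_def real_nat_ceiling_ge)
      have "- (p powr q) \<le> F k" using adams_bound_powr_le[OF p q P, of k] by (simp add: F_def)
      moreover have "0 \<le> p powr q" by simp
      ultimately have "real j \<le> F k + (1 + p powr q)"
        using ceiling_correct[of "F k"] j_def by (cases "0 \<le> F k") linarith+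
      then have "d * real j \<le> d * (F k + (1 + p powr q))" using d by (intro mult_left_mono) auto
      then have "exp (- (d * F k)) \<le> c * exp (- (d * real j))"
        by (simp add: c_def exp_add[symmetric] algebra_simps)
      then have "ennreal (exp (- (d * F k))) \<le> ennreal (c * exp (- (d * real j))) * indicator {k. F k \<le> real j} k"
        using j by (simp add: ennreal_leI)
      also have "\<dots> \<le> (\<Sum>j. ennreal (c * exp (- (d * real j))) * indicator {k. F k \<le> real j} k)"
        by (rule ennreal_le_suminf)
      finally show ?thesis .
    qed
    have "(\<Sum>k. ennreal (exp (d * (adams_bound p P k powr q - real k)))) = (\<Sum>k. ennreal (exp (- (d * F k))))"
      by (simp add: F_def algebra_simps)
    also have "\<dots> = (\<integral>\<^sup>+k. ennreal (exp (- (d * F k))) \<partial>count_space UNIV)"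
      by (simp add: nn_integral_count_space_nat)
    also have "\<dots> \<le> (\<integral>\<^sup>+k. (\<Sum>j. ennreal (c * exp (- (d * real j))) * indicator {k. F k \<le> real j} k) \<partial>count_space UNIV)"
      by (intro nn_integral_mono bound)
    also have "\<dots> = (\<Sum>j. \<integral>\<^sup>+k. ennreal (c * exp (- (d * real j))) * indicator {k. F k \<le> real j} k \<partial>count_space UNIV)"
      by (intro nn_integral_suminf) auto
    also have "\<dots> = (\<Sum>j. ennreal (c * exp (- (d * real j))) * emeasure (count_space UNIV) {k. F k \<le> real j})"
      by (simp add: nn_integral_cmult_indicator)
    also have "\<dots> \<le> (\<Sum>j. ennreal (c * C * ((1 + real j) * exp (- (d * real j)))))"
    proof (intro suminf_le)
      fix j
      have "finite {k. F k \<le> real j}" "real (card {k. F k \<le> real j}) \<le> C * (1 + real j)"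
        using C(2)[OF P, of "real j"] by (auto simp: F_def)
      then have "ennreal (c * exp (- (d * real j))) * emeasure (count_space UNIV) {k. F k \<le> real j} \<le>
          ennreal (c * exp (- (d * real j))) * ennreal (C * (1 + real j))"
        by (intro mult_left_mono) (auto simp: ennreal_of_nat_eq_real_of_nat ennreal_leI)
      also have "\<dots> = ennreal (c * C * ((1 + real j) * exp (- (d * real j))))"
        using c C by (simp add: ennreal_mult[symmetric] mult_ac)
      finally show "ennreal (c * exp (- (d * real j))) * emeasure (count_space UNIV) {k. F k \<le> real j} \<le>
          ennreal (c * C * ((1 + real j) * exp (- (d * real j))))" .
    qed auto
    also have "\<dots> = ennreal (\<Sum>j. c * C * ((1 + real j) * exp (- (d * real j))))"
      using c C by (intro suminf_ennreal_eq summable_sums summable_mult summable_linear_times_exp d) auto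
    finally show "(\<Sum>k. ennreal (exp (d * (adams_bound p P k powr q - real k)))) \<le>
        ennreal (\<Sum>j. c * C * ((1 + real j) * exp (- (d * real j))))" .
  qed
qed

section \<open>The bathtub principle for powers of the distance\<close>

lemma nn_integral_powr_Icc_0:
  fixes a c :: real
  assumes "- 1 < a" "0 \<le> c"
  shows "(\<integral>\<^sup>+x. ennreal (x powr a) * indicator {0..c} x \<partial>lborel) = ennreal (c powr (a + 1) / (a + 1))"
  using assms has_integral_powr_from_0[of a c] by (intro nn_integral_has_integral_lebesgue') auto

text \<open>A layer-cake formula: with \<open>c\<close> a distance and \<open>x\<close> a radius, it
  writes the kernel as a superposition of indicators of balls.\<close>

lemma nn_integral_powr_atLeast:
  fixes a c :: real
  assumes "0 < a" "0 < c"
  shows "(\<integral>\<^sup>+x. ennreal (a * x powr (- a - 1)) * indicator {c..} x \<partial>lborel) = ennreal (c powr - a)"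
proof -
  have "((\<lambda>x. - (x powr - a)) \<longlongrightarrow> - 0) at_top"
    using assms by (intro tendsto_minus tendsto_neg_powr filterlim_ident) auto
  then have "(\<integral>\<^sup>+x. ennreal (a * x powr (- a - 1)) * indicator {c..} x \<partial>lborel) = ennreal (- 0 - - (c powr - a))"
    using assms by (intro nn_integral_FTC_atLeast) (auto intro!: derivative_eq_intros simp: powr_diff)
  then show ?thesis by simp
qed

text \<open>The bound is the value of the integral for a ball of measure \<open>r\<close> centred at \<open>x\<close>.\<close>

lemma nn_integral_norm_powr_le:
  fixes x :: "'a::euclidean_space" and a r :: real
  defines "n \<equiv> real DIM('a)"
  defines "v \<equiv> unit_ball_vol n"
  assumes a: "0 \<le> a" "a < n" and B[measurable]: "B \<in> sets borel"
    and r: "emeasure lborel B \<le> ennreal r" "0 \<le> r"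
  shows "(\<integral>\<^sup>+y. ennreal (norm (x - y) powr - a) * indicator B y \<partial>lborel)
     \<le> ennreal (v powr (a / n) / (1 - a / n) * r powr (1 - a / n))"
proof -
  have n: "0 < n" by (simp add: n_def)
  then have v: "0 < v" by (simp add: v_def)
  \<comment> \<open>The main case needs a positive radius \<open>R\<close> and, for the layer cake,
    \<open>a > 0\<close>.\<close>
  consider "r = 0" | "a = 0" "0 < r" | "0 < a" "0 < r" using a r by linarith
  then show ?thesis
  proof cases
    case 1
    then have "AE y in lborel. y \<notin> B"
      using r by (intro AE_not_in) (auto simp: null_sets_def)
    then have "(\<integral>\<^sup>+y. ennreal (norm (x - y) powr - a) * indicator B y \<partial>lborel) = 0"
      by (subst nn_integral_0_iff_AE) (auto simp: indicator_def elim!: eventually_mono)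
    then show ?thesis by simp
  next
    case 2
    have "(\<integral>\<^sup>+y. ennreal (norm (x - y) powr - a) * indicator B y \<partial>lborel) \<le> (\<integral>\<^sup>+y. indicator B y \<partial>lborel)"
      using 2 by (intro nn_integral_mono) (auto simp: indicator_def)
    then show ?thesis using r 2 v by simp
  next
    case 3
    \<comment> \<open>The radius of a ball of measure \<open>r\<close>.\<close>
    define R where "R = (r / v) powr (1 / n)"
    have R: "0 < R" "R powr n = r / v" using 3 v n by (auto simp: R_def powr_powr)
    have vol: "emeasure lborel (B \<inter> cball x \<rho>) \<le> ennreal (v * \<rho> powr n)" if "0 \<le> \<rho>" for \<rho>
    proof -
      have "emeasure lborel (B \<inter> cball x \<rho>) \<le> emeasure lborel (cball x \<rho>)"
        by (intro emeasure_mono) auto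
      also have "\<dots> = ennreal (v * \<rho> ^ DIM('a))" using that by (simp add: emeasure_cball v_def n_def)
      also have "\<rho> ^ DIM('a) = \<rho> powr n"
        using that by (cases "\<rho> = 0") (auto simp: n_def powr_realpow)
      finally show ?thesis .
    qed
    \<comment> \<open>Only an inequality: at \<open>y = x\<close> the kernel has the default value
      0, while the integral over \<open>\<rho>\<close> diverges.\<close>
    have "(\<integral>\<^sup>+y. ennreal (norm (x - y) powr - a) * indicator B y \<partial>lborel) \<le>
        (\<integral>\<^sup>+y. (\<integral>\<^sup>+\<rho>. ennreal (a * \<rho> powr (- a - 1)) * indicator {norm (x - y)..} \<rho> \<partial>lborel) * indicator B y \<partial>lborel)"
    proof (intro nn_integral_mono mult_right_mono)
      fix y
      show "ennreal (norm (x - y) powr - a) \<le>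
          (\<integral>\<^sup>+\<rho>. ennreal (a * \<rho> powr (- a - 1)) * indicator {norm (x - y)..} \<rho> \<partial>lborel)"
        using nn_integral_powr_atLeast[of a "norm (x - y)"] 3 by (cases "x = y") auto
    qed auto
    also have "\<dots> = (\<integral>\<^sup>+y. (\<integral>\<^sup>+\<rho>. ennreal (a * \<rho> powr (- a - 1)) * (if norm (x - y) \<le> \<rho> \<and> y \<in> B then 1 else 0) \<partial>lborel) \<partial>lborel)"
      by (subst nn_integral_multc[symmetric])
         (auto intro!: nn_integral_cong simp: indicator_def)
    also have "\<dots> = (\<integral>\<^sup>+\<rho>. (\<integral>\<^sup>+y. ennreal (a * \<rho> powr (- a - 1)) * (if norm (x - y) \<le> \<rho> \<and> y \<in> B then 1 else 0) \<partial>lborel) \<partial>lborel)"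
      by (rule lborel_pair.Fubini') measurable
    also have "\<dots> = (\<integral>\<^sup>+\<rho>. (\<integral>\<^sup>+y. ennreal (a * \<rho> powr (- a - 1)) * indicator (B \<inter> cball x \<rho>) y \<partial>lborel) \<partial>lborel)"
      by (intro nn_integral_cong) (auto simp: indicator_def dist_norm)
    also have "\<dots> = (\<integral>\<^sup>+\<rho>. ennreal (a * \<rho> powr (- a - 1)) * emeasure lborel (B \<inter> cball x \<rho>) \<partial>lborel)"
      by (intro nn_integral_cong nn_integral_cmult_indicator) auto
    \<comment> \<open>Up to the radius \<open>R\<close> the volume of the ball is the better bound,
      beyond it the measure of \<open>B\<close>.\<close>
    also have "\<dots> \<le> (\<integral>\<^sup>+\<rho>. ennreal (a * v) * (ennreal (\<rho> powr (n - a - 1)) * indicator {0..R} \<rho>)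
        + ennreal r * (ennreal (a * \<rho> powr (- a - 1)) * indicator {R..} \<rho>) \<partial>lborel)"
    proof (intro nn_integral_mono)
      fix \<rho> :: real
      consider "\<rho> < 0" | "0 \<le> \<rho>" "\<rho> \<le> R" | "R < \<rho>" by linarith
      then show "ennreal (a * \<rho> powr (- a - 1)) * emeasure lborel (B \<inter> cball x \<rho>) \<le>
          ennreal (a * v) * (ennreal (\<rho> powr (n - a - 1)) * indicator {0..R} \<rho>)
          + ennreal r * (ennreal (a * \<rho> powr (- a - 1)) * indicator {R..} \<rho>)"
      proof cases
        case 2
        have "ennreal (a * \<rho> powr (- a - 1)) * emeasure lborel (B \<inter> cball x \<rho>) \<le>
            ennreal (a * \<rho> powr (- a - 1)) * ennreal (v * \<rho> powr n)"
          using vol 2 by (intro mult_left_mono) auto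
        also have "\<dots> = ennreal ((a * v) * \<rho> powr (n - a - 1))"
          using \<open>0 < a\<close> v 2
          by (cases "\<rho> = 0") (simp_all add: ennreal_mult[symmetric] powr_diff powr_minus powr_add field_simps)
        also have "\<dots> = ennreal (a * v) * (ennreal (\<rho> powr (n - a - 1)) * indicator {0..R} \<rho>)"
          using 2 \<open>0 < a\<close> v by (simp add: ennreal_mult)
        finally show ?thesis by (rule add_increasing2[rotated]) simp
      next
        case 3
        have "emeasure lborel (B \<inter> cball x \<rho>) \<le> emeasure lborel B" by (intro emeasure_mono) auto
        then have "ennreal (a * \<rho> powr (- a - 1)) * emeasure lborel (B \<inter> cball x \<rho>) \<le>
            ennreal (a * \<rho> powr (- a - 1)) * ennreal r"
          using r by (intro mult_left_mono) auto
        also have "\<dots> = ennreal r * (ennreal (a * \<rho> powr (- a - 1)) * indicator {R..} \<rho>)"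
          using 3 by (simp add: mult.commute)
        finally show ?thesis by (rule add_increasing[rotated]) simp
      qed auto
    qed
    also have "\<dots> = ennreal (a * v) * ennreal (R powr (n - a - 1 + 1) / (n - a - 1 + 1)) + ennreal r * ennreal (R powr - a)"
      using nn_integral_powr_Icc_0[of "n - a - 1" R] nn_integral_powr_atLeast[of a R] R a 3
      by (simp add: nn_integral_add nn_integral_cmult)
    also have "\<dots> = ennreal (a * v * (R powr (n - a) / (n - a)) + r * R powr - a)"
      using R a 3 v by (simp add: ennreal_mult[symmetric] ennreal_plus[symmetric] del: ennreal_plus)
    \<comment> \<open>\<open>v * R powr n = r\<close> merges the two pieces.\<close>
    also have "a * v * (R powr (n - a) / (n - a)) + r * R powr - a = r * R powr - a * (n / (n - a))"
      using R a v by (simp add: powr_diff powr_minus field_simps)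
    also have "R powr - a = v powr (a / n) * r powr (- a / n)"
      using 3 v by (simp add: R_def powr_powr powr_divide powr_minus field_simps)
    also have "r * (v powr (a / n) * r powr (- a / n)) * (n / (n - a)) = v powr (a / n) / (1 - a / n) * r powr (1 - a / n)"
    proof -
      have "r * r powr (- a / n) = r powr (1 - a / n)"
        using 3 powr_add[of r 1 "- a / n"] by simp
      moreover have "n / (n - a) = 1 / (1 - a / n)" using n a by (simp add: field_simps)
      ultimately show ?thesis by (simp add: mult_ac)
    qed
    finally show ?thesis .
  qed
qed

section \<open>O'Neil's inequality\<close>

definition distribution_fun :: "('a::euclidean_space \<Rightarrow> real) \<Rightarrow> real \<Rightarrow> real" where
  "distribution_fun g \<tau> = measure lborel {y. \<tau> < g y}"

text \<open>Under the hypotheses below, the set of levels is an interval with left end point 0 for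
  \<open>s > 0\<close>, so its length is the usual rearrangement. As the measure of a section it
  fits Tonelli's theorem better than an infimum would.\<close>

definition decreasing_rearrangement :: "('a::euclidean_space \<Rightarrow> real) \<Rightarrow> real \<Rightarrow> real" where
  "decreasing_rearrangement g s = measure lborel {\<tau>. 0 < \<tau> \<and> s < distribution_fun g \<tau>}"

text \<open>The function \<open>s powr (- 1 / q)\<close> with its values on \<open>(0, t]\<close>
  replaced by their mean.\<close>

definition oneil_kernel :: "real \<Rightarrow> real \<Rightarrow> real \<Rightarrow> real \<Rightarrow> real" where
  "oneil_kernel p q t s = (if s \<le> t then p * t powr (- 1 / q) else s powr (- 1 / q))"

lemma measurable_oneil_kernel [measurable]: "oneil_kernel p q t \<in> borel_measurable borel"
  unfolding oneil_kernel_def by measurable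

lemma oneil_kernel_nonneg: "0 \<le> p \<Longrightarrow> 0 \<le> oneil_kernel p q t s"
  by (simp add: oneil_kernel_def)

text \<open>The integral equals \<open>p * r * t powr (- 1 / q)\<close> for \<open>r \<le> t\<close>
  and \<open>p * r powr (1 / p)\<close> otherwise. The two entries come from the bathtub bounds for
  a superlevel set of measure \<open>r\<close>; as an integral over \<open>s < r\<close> their
  minimum can be integrated over the levels.\<close>

lemma min_le_nn_integral_oneil_kernel:
  fixes p q t r :: real
  assumes p: "1 < p" and q: "q = p / (p - 1)" and t: "0 < t" and r: "0 \<le> r"
  shows "ennreal (min (p * r powr (1 / p)) (p * r * t powr (- 1 / q)))
    \<le> (\<integral>\<^sup>+s. ennreal (oneil_kernel p q t s) * indicator {0<..<r} s \<partial>lborel)"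
proof -
  have q1: "- 1 / q = 1 / p - 1" "- (1 / q) = 1 / p - 1" using conjugate_exponent[OF p q] by simp_all
  show ?thesis
  proof (cases "r \<le> t")
    case True
    have "ennreal (min (p * r powr (1 / p)) (p * r * t powr (- 1 / q))) \<le> ennreal (p * t powr (- 1 / q) * r)"
      by (intro ennreal_leI) (simp add: mult_ac)
    also have "\<dots> = (\<integral>\<^sup>+s. ennreal (p * t powr (- 1 / q)) * indicator {0<..<r} s \<partial>lborel)"
      using p r by (simp add: nn_integral_cmult_indicator ennreal_mult)
    also have "\<dots> = (\<integral>\<^sup>+s. ennreal (oneil_kernel p q t s) * indicator {0<..<r} s \<partial>lborel)"
      using True by (intro nn_integral_cong) (auto simp: oneil_kernel_def indicator_def)
    finally show ?thesis .
  next
    case False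
    have "(\<integral>\<^sup>+s. ennreal (s powr (- 1 / q)) * indicator {t..r} s \<partial>lborel) =
        ennreal (p * r powr (1 / p) - p * t powr (1 / p))"
      using False t p by (intro nn_integral_FTC_Icc) (auto intro!: derivative_eq_intros simp: q1)
    moreover have "(\<integral>\<^sup>+s. ennreal (p * t powr (- 1 / q)) * indicator {0..t} s \<partial>lborel) = ennreal (p * t powr (1 / p))"
      using p t by (simp add: nn_integral_cmult_indicator ennreal_mult[symmetric] q1 powr_diff)
    moreover have "t powr (1 / p) \<le> r powr (1 / p)" using False t p by (intro powr_mono2) auto
    ultimately have "ennreal (p * r powr (1 / p)) =
       (\<integral>\<^sup>+s. ennreal (p * t powr (- 1 / q)) * indicator {0..t} s + ennreal (s powr (- 1 / q)) * indicator {t..r} s \<partial>lborel)"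
      using p by (simp add: nn_integral_add ennreal_plus[symmetric] del: ennreal_plus)
    also have "\<dots> \<le> (\<integral>\<^sup>+s. ennreal (oneil_kernel p q t s) * indicator {0<..<r} s \<partial>lborel)"
    proof (intro nn_integral_mono_AE)
      have "AE s in lborel. s \<noteq> (0::real)" "AE s in lborel. s \<noteq> t" "AE s in lborel. s \<noteq> r"
        by (rule AE_lborel_singleton)+
      then show "AE s in lborel. ennreal (p * t powr (- 1 / q)) * indicator {0..t} s + ennreal (s powr (- 1 / q)) * indicator {t..r} s
          \<le> ennreal (oneil_kernel p q t s) * indicator {0<..<r} s"
        by eventually_elim (use False t in \<open>auto simp: indicator_def oneil_kernel_def\<close>)
    qed
    finally show ?thesis by (rule order.trans[rotated]) (simp add: ennreal_leI)
  qed
qed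

text \<open>The \<open>P\<^sub>k\<close> of the overview. Under the hypotheses below the integral is
  at most 1, so the conversion to a real number loses nothing.\<close>

definition layer_mass :: "real \<Rightarrow> real \<Rightarrow> ('a::euclidean_space \<Rightarrow> real) \<Rightarrow> nat \<Rightarrow> real" where
  "layer_mass p V g k = enn2real (\<integral>\<^sup>+s. ennreal (decreasing_rearrangement g s powr p) *
     indicator {0<..V * exp (- real k)} s \<partial>lborel)"

lemma layer_mass_nonneg: "0 \<le> layer_mass p V g k"
  by (simp add: layer_mass_def)

lemma distribution_fun_nonneg: "0 \<le> distribution_fun g \<tau>"
  by (simp add: distribution_fun_def)

lemma decreasing_rearrangement_nonneg: "0 \<le> decreasing_rearrangement g s"
  by (simp add: decreasing_rearrangement_def)

text \<open>The measure is rewritten as an integral of a jointly measurable function, so that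
  measurability of parameter integrals applies.\<close>

lemma measurable_distribution_fun [measurable]:
  fixes g :: "'a::euclidean_space \<Rightarrow> real"
  assumes [measurable]: "g \<in> borel_measurable borel"
  shows "distribution_fun g \<in> borel_measurable borel"
proof -
  have "(\<lambda>\<tau>. enn2real (\<integral>\<^sup>+y. (if \<tau> < g y then 1 else 0) \<partial>lborel)) \<in> borel_measurable borel"
    by measurable
  also have "(\<lambda>\<tau>. enn2real (\<integral>\<^sup>+y. (if \<tau> < g y then 1 else 0) \<partial>lborel)) = distribution_fun g"
  proof
    fix \<tau>
    have "(\<integral>\<^sup>+y. (if \<tau> < g y then 1 else 0) \<partial>lborel) = (\<integral>\<^sup>+y. indicator {y. \<tau> < g y} y \<partial>lborel)"
      by (intro nn_integral_cong) (auto simp: indicator_def)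
    then show "enn2real (\<integral>\<^sup>+y. (if \<tau> < g y then 1 else 0) \<partial>lborel) = distribution_fun g \<tau>"
      by (simp add: distribution_fun_def measure_def)
  qed
  finally show ?thesis .
qed

lemma measurable_decreasing_rearrangement [measurable]:
  fixes g :: "'a::euclidean_space \<Rightarrow> real"
  assumes [measurable]: "g \<in> borel_measurable borel"
  shows "decreasing_rearrangement g \<in> borel_measurable borel"
proof -
  have "(\<lambda>s. enn2real (\<integral>\<^sup>+\<tau>. (if 0 < \<tau> \<and> s < distribution_fun g \<tau> then 1 else 0) \<partial>lborel)) \<in> borel_measurable borel"
    by measurable
  also have "(\<lambda>s. enn2real (\<integral>\<^sup>+\<tau>. (if 0 < \<tau> \<and> s < distribution_fun g \<tau> then 1 else 0) \<partial>lborel)) = decreasing_rearrangement g"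
  proof
    fix s
    have "(\<integral>\<^sup>+\<tau>. (if 0 < \<tau> \<and> s < distribution_fun g \<tau> then 1 else 0) \<partial>lborel) =
        (\<integral>\<^sup>+\<tau>. indicator {\<tau>. 0 < \<tau> \<and> s < distribution_fun g \<tau>} \<tau> \<partial>lborel)"
      by (intro nn_integral_cong) (auto simp: indicator_def)
    then show "enn2real (\<integral>\<^sup>+\<tau>. (if 0 < \<tau> \<and> s < distribution_fun g \<tau> then 1 else 0) \<partial>lborel) = decreasing_rearrangement g s"
      by (simp add: decreasing_rearrangement_def measure_def)
  qed
  finally show ?thesis .
qed

section \<open>Rearrangement of a nonnegative function of \<open>p\<close>-norm at most 1\<close>

context
  fixes g :: "'a::euclidean_space \<Rightarrow> real" and p V :: real
  assumes g [measurable]: "g \<in> borel_measurable borel" and g0: "\<And>y. 0 \<le> g y"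
    and p: "1 < p"
    and gp: "(\<integral>\<^sup>+y. ennreal (g y powr p) \<partial>lborel) \<le> 1"
    and V: "0 < V" "\<And>\<tau>. 0 < \<tau> \<Longrightarrow> emeasure lborel {y. \<tau> < g y} \<le> ennreal V"
begin

lemma emeasure_superlevel:
  assumes "0 < \<tau>"
  shows "emeasure lborel {y. \<tau> < g y} = ennreal (distribution_fun g \<tau>)"
proof -
  have "emeasure lborel {y. \<tau> < g y} < \<infinity>" using V(2)[OF assms] by (simp add: le_less_trans)
  then show ?thesis by (simp add: distribution_fun_def emeasure_eq_ennreal_measure)
qed

lemma distribution_fun_le: "0 < \<tau> \<Longrightarrow> distribution_fun g \<tau> \<le> V"
  using emeasure_superlevel[of \<tau>] V(1) V(2)[of \<tau>] by simp

lemma distribution_fun_antimono: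
  assumes "0 < \<sigma>" "\<sigma> \<le> \<tau>"
  shows "distribution_fun g \<tau> \<le> distribution_fun g \<sigma>"
proof -
  have "emeasure lborel {y. \<tau> < g y} \<le> emeasure lborel {y. \<sigma> < g y}"
    using assms by (intro emeasure_mono) auto
  then show ?thesis using assms emeasure_superlevel[of \<tau>] emeasure_superlevel[of \<sigma>]
    by (simp add: distribution_fun_nonneg)
qed

text \<open>Chebyshev's inequality. It bounds the levels entering the rearrangement at
  \<open>s\<close>, whose set therefore has finite measure.\<close>

lemma superlevel_le:
  assumes "0 < s" "0 < \<tau>" "s < distribution_fun g \<tau>"
  shows "\<tau> \<le> s powr (- 1 / p)"
proof -
  have "ennreal (s * \<tau> powr p) \<le> ennreal (\<tau> powr p) * ennreal (distribution_fun g \<tau>)"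
    using assms by (simp add: ennreal_mult'[symmetric] mult.commute mult_left_mono)
  also have "\<dots> = (\<integral>\<^sup>+y. ennreal (\<tau> powr p) * indicator {y. \<tau> < g y} y \<partial>lborel)"
    using assms by (simp add: nn_integral_cmult_indicator emeasure_superlevel)
  also have "\<dots> \<le> (\<integral>\<^sup>+y. ennreal (g y powr p) \<partial>lborel)"
    using assms p by (intro nn_integral_mono) (auto simp: indicator_def intro!: ennreal_leI powr_mono2)
  also note gp
  finally have "s * \<tau> powr p \<le> 1" by simp
  then have "\<tau> powr p \<le> 1 / s" using assms by (simp add: field_simps)
  then have "(\<tau> powr p) powr (1 / p) \<le> (1 / s) powr (1 / p)" using p by (intro powr_mono2) auto
  then show ?thesis using assms p by (simp add: powr_powr powr_divide powr_minus_divide)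
qed

lemma emeasure_superlevel_distribution:
  assumes "0 < s"
  shows "emeasure lborel {\<tau>. 0 < \<tau> \<and> s < distribution_fun g \<tau>} = ennreal (decreasing_rearrangement g s)"
proof -
  have "emeasure lborel {\<tau>. 0 < \<tau> \<and> s < distribution_fun g \<tau>} \<le> emeasure lborel {0..s powr (- 1 / p)}"
    using assms superlevel_le by (intro emeasure_mono) auto
  then have "emeasure lborel {\<tau>. 0 < \<tau> \<and> s < distribution_fun g \<tau>} < \<infinity>"
    by (simp add: le_less_trans)
  then show ?thesis by (simp add: decreasing_rearrangement_def emeasure_eq_ennreal_measure)
qed

lemma decreasing_rearrangement_eq_0: "V \<le> s \<Longrightarrow> decreasing_rearrangement g s = 0"
proof -
  assume "V \<le> s"
  then have "{\<tau>. 0 < \<tau> \<and> s < distribution_fun g \<tau>} = {}" using distribution_fun_le by force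
  then show ?thesis unfolding decreasing_rearrangement_def by (simp only: measure_empty)
qed

text \<open>The distribution function decreases, so the set of levels contains all of
  \<open>(0, l)\<close>, where \<open>l\<close> is its supremum. The rearrangement is at most
  \<open>l\<close>, and \<open>l powr p\<close> is the integral of
  \<open>p * \<tau> powr (p - 1)\<close> up to \<open>l\<close>.\<close>

lemma decreasing_rearrangement_powr_le:
  assumes s: "0 < s"
  shows "ennreal (decreasing_rearrangement g s powr p) \<le>
    (\<integral>\<^sup>+\<tau>. ennreal (p * \<tau> powr (p - 1)) * indicator {\<tau>. 0 < \<tau> \<and> s < distribution_fun g \<tau>} \<tau> \<partial>lborel)"
proof -
  define S where "S = {\<tau>. 0 < \<tau> \<and> s < distribution_fun g \<tau>}"
  show ?thesis
  proof (cases "S = {}")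
    case True
    then show ?thesis unfolding decreasing_rearrangement_def S_def[symmetric] by simp
  next
    case False
    define l where "l = Sup S"
    have bdd: "bdd_above S" using superlevel_le[OF s] unfolding S_def by (intro bdd_aboveI) blast
    have le: "\<tau> \<le> l" if "\<tau> \<in> S" for \<tau> unfolding l_def using bdd that by (rule cSup_upper[rotated])
    then have l0: "0 \<le> l" using False S_def by force
    have "emeasure lborel S \<le> emeasure lborel {0..l}"
      using le by (intro emeasure_mono) (auto simp: S_def)
    then have fl: "decreasing_rearrangement g s \<le> l"
      using emeasure_superlevel_distribution[OF s] l0 by (simp add: S_def)
    have sub: "{0<..<l} \<subseteq> S"
    proof
      fix \<tau> assume \<tau>: "\<tau> \<in> {0<..<l}"
      then obtain \<sigma> where "\<sigma> \<in> S" "\<tau> < \<sigma>" using less_cSupD[OF False] by (auto simp: l_def)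
      then show "\<tau> \<in> S" using \<tau> distribution_fun_antimono[of \<tau> \<sigma>] by (auto simp: S_def)
    qed
    have "ennreal (decreasing_rearrangement g s powr p) \<le> ennreal (l powr p)"
      using fl p decreasing_rearrangement_nonneg by (intro ennreal_leI powr_mono2) auto
    also have "\<dots> = ennreal p * ennreal (l powr (p - 1 + 1) / (p - 1 + 1))"
      using p by (simp add: ennreal_mult[symmetric])
    also have "\<dots> = (\<integral>\<^sup>+\<tau>. ennreal p * (ennreal (\<tau> powr (p - 1)) * indicator {0..l} \<tau>) \<partial>lborel)"
      using nn_integral_powr_Icc_0[of "p - 1" l] p l0 by (simp add: nn_integral_cmult)
    also have "\<dots> \<le> (\<integral>\<^sup>+\<tau>. ennreal (p * \<tau> powr (p - 1)) * indicator S \<tau> \<partial>lborel)"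
    proof (intro nn_integral_mono_AE)
      have "AE \<tau> in lborel. \<tau> \<noteq> 0" "AE \<tau> in lborel. \<tau> \<noteq> l" by (rule AE_lborel_singleton)+
      then show "AE \<tau> in lborel. ennreal p * (ennreal (\<tau> powr (p - 1)) * indicator {0..l} \<tau>) \<le>
          ennreal (p * \<tau> powr (p - 1)) * indicator S \<tau>"
        by eventually_elim (use sub p in \<open>auto simp: indicator_def ennreal_mult' subset_iff\<close>)
    qed
    finally show ?thesis by (simp add: S_def)
  qed
qed

text \<open>Both \<open>p\<close>-th powers are layered by \<open>p * \<tau> powr (p - 1)\<close>.
  At each level the interval \<open>0 < s < distribution_fun g \<tau>\<close> has the measure of the
  superlevel set of \<open>g\<close>, so Tonelli's theorem leads from the rearrangement to the
  levels and from there back to \<open>g\<close>.\<close>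

lemma nn_integral_decreasing_rearrangement:
  "(\<integral>\<^sup>+s. ennreal (decreasing_rearrangement g s powr p) * indicator {0<..} s \<partial>lborel) \<le> 1"
proof -
  have "(\<integral>\<^sup>+s. ennreal (decreasing_rearrangement g s powr p) * indicator {0<..} s \<partial>lborel) \<le>
     (\<integral>\<^sup>+s. (\<integral>\<^sup>+\<tau>. ennreal (p * \<tau> powr (p - 1)) * (if 0 < s \<and> 0 < \<tau> \<and> s < distribution_fun g \<tau> then 1 else 0) \<partial>lborel) \<partial>lborel)"
  proof (intro nn_integral_mono)
    fix s :: real
    show "ennreal (decreasing_rearrangement g s powr p) * indicator {0<..} s \<le>
      (\<integral>\<^sup>+\<tau>. ennreal (p * \<tau> powr (p - 1)) * (if 0 < s \<and> 0 < \<tau> \<and> s < distribution_fun g \<tau> then 1 else 0) \<partial>lborel)"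
      using decreasing_rearrangement_powr_le[of s]
      by (cases "0 < s") (auto simp: indicator_def of_bool_def)
  qed
  also have "\<dots> = (\<integral>\<^sup>+\<tau>. (\<integral>\<^sup>+s. ennreal (p * \<tau> powr (p - 1)) * (if 0 < s \<and> 0 < \<tau> \<and> s < distribution_fun g \<tau> then 1 else 0) \<partial>lborel) \<partial>lborel)"
    by (rule lborel_pair.Fubini') measurable
  also have "\<dots> = (\<integral>\<^sup>+\<tau>. (\<integral>\<^sup>+y. ennreal (p * \<tau> powr (p - 1)) * (if 0 < \<tau> \<and> \<tau> < g y then 1 else 0) \<partial>lborel) \<partial>lborel)"
  proof (intro nn_integral_cong)
    fix \<tau> :: real
    show "(\<integral>\<^sup>+s. ennreal (p * \<tau> powr (p - 1)) * (if 0 < s \<and> 0 < \<tau> \<and> s < distribution_fun g \<tau> then 1 else 0) \<partial>lborel) =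
      (\<integral>\<^sup>+y. ennreal (p * \<tau> powr (p - 1)) * (if 0 < \<tau> \<and> \<tau> < g y then 1 else 0) \<partial>lborel)"
    proof (cases "0 < \<tau>")
      case True
      have "(\<integral>\<^sup>+s. ennreal (p * \<tau> powr (p - 1)) * (if 0 < s \<and> 0 < \<tau> \<and> s < distribution_fun g \<tau> then 1 else 0) \<partial>lborel) =
         (\<integral>\<^sup>+s. ennreal (p * \<tau> powr (p - 1)) * indicator {0<..<distribution_fun g \<tau>} s \<partial>lborel)"
        using True by (intro nn_integral_cong) (auto simp: indicator_def)
      also have "\<dots> = ennreal (p * \<tau> powr (p - 1)) * emeasure lborel {y. \<tau> < g y}"
        using True by (simp add: nn_integral_cmult_indicator emeasure_superlevel distribution_fun_nonneg)
      also have "\<dots> = (\<integral>\<^sup>+y. ennreal (p * \<tau> powr (p - 1)) * indicator {y. \<tau> < g y} y \<partial>lborel)"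
        by (simp add: nn_integral_cmult_indicator)
      also have "\<dots> = (\<integral>\<^sup>+y. ennreal (p * \<tau> powr (p - 1)) * (if 0 < \<tau> \<and> \<tau> < g y then 1 else 0) \<partial>lborel)"
        using True by (intro nn_integral_cong) (auto simp: indicator_def)
      finally show ?thesis .
    qed auto
  qed
  also have "\<dots> = (\<integral>\<^sup>+y. (\<integral>\<^sup>+\<tau>. ennreal (p * \<tau> powr (p - 1)) * (if 0 < \<tau> \<and> \<tau> < g y then 1 else 0) \<partial>lborel) \<partial>lborel)"
    by (rule lborel_pair.Fubini') measurable
  also have "\<dots> \<le> (\<integral>\<^sup>+y. ennreal (g y powr p) \<partial>lborel)"
  proof (intro nn_integral_mono)
    fix y
    have "(\<integral>\<^sup>+\<tau>. ennreal (p * \<tau> powr (p - 1)) * (if 0 < \<tau> \<and> \<tau> < g y then 1 else 0) \<partial>lborel) \<le>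
      (\<integral>\<^sup>+\<tau>. ennreal p * (ennreal (\<tau> powr (p - 1)) * indicator {0..g y} \<tau>) \<partial>lborel)"
      using p by (intro nn_integral_mono) (auto simp: indicator_def ennreal_mult)
    also have "\<dots> = ennreal p * ennreal (g y powr (p - 1 + 1) / (p - 1 + 1))"
      using nn_integral_powr_Icc_0[of "p - 1" "g y"] p g0 by (simp add: nn_integral_cmult)
    also have "\<dots> = ennreal (g y powr p)" using p by (simp add: ennreal_mult[symmetric])
    finally show "(\<integral>\<^sup>+\<tau>. ennreal (p * \<tau> powr (p - 1)) * (if 0 < \<tau> \<and> \<tau> < g y then 1 else 0) \<partial>lborel) \<le> ennreal (g y powr p)" .
  qed
  also note gp
  finally show ?thesis .
qed


lemma layer_mass_eq:
  "(\<integral>\<^sup>+s. ennreal (decreasing_rearrangement g s powr p) * indicator {0<..V * exp (- real k)} s \<partial>lborel)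
    = ennreal (layer_mass p V g k)"
  and layer_mass_le_1: "layer_mass p V g k \<le> 1"
proof -
  have "(\<integral>\<^sup>+s. ennreal (decreasing_rearrangement g s powr p) * indicator {0<..V * exp (- real k)} s \<partial>lborel) \<le>
     (\<integral>\<^sup>+s. ennreal (decreasing_rearrangement g s powr p) * indicator {0<..} s \<partial>lborel)"
    by (intro nn_integral_mono mult_left_mono) (auto simp: indicator_def)
  also note nn_integral_decreasing_rearrangement
  finally have le: "(\<integral>\<^sup>+s. ennreal (decreasing_rearrangement g s powr p) * indicator {0<..V * exp (- real k)} s \<partial>lborel) \<le> 1" .
  then show eq: "(\<integral>\<^sup>+s. ennreal (decreasing_rearrangement g s powr p) * indicator {0<..V * exp (- real k)} s \<partial>lborel)
    = ennreal (layer_mass p V g k)"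
    unfolding layer_mass_def by (subst ennreal_enn2real) (auto simp: le_less_trans)
  show "layer_mass p V g k \<le> 1" using le unfolding eq by simp
qed

lemma layer_mass_diff:
  "(\<integral>\<^sup>+s. ennreal (decreasing_rearrangement g s powr p) * indicator {V * exp (- real (Suc k))<..V * exp (- real k)} s \<partial>lborel)
    = ennreal (layer_mass p V g k - layer_mass p V g (Suc k))"
  and layer_mass_Suc_le: "layer_mass p V g (Suc k) \<le> layer_mass p V g k"
proof -
  let ?D = "\<integral>\<^sup>+s. ennreal (decreasing_rearrangement g s powr p) * indicator {V * exp (- real (Suc k))<..V * exp (- real k)} s \<partial>lborel"
  have t: "0 < V * exp (- real (Suc k))" "V * exp (- real (Suc k)) \<le> V * exp (- real k)"
    using V(1) by auto
  have "ennreal (layer_mass p V g k) = (\<integral>\<^sup>+s. ennreal (decreasing_rearrangement g s powr p) * indicator {0<..V * exp (- real (Suc k))} s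
      + ennreal (decreasing_rearrangement g s powr p) * indicator {V * exp (- real (Suc k))<..V * exp (- real k)} s \<partial>lborel)"
    unfolding layer_mass_eq[symmetric] using t by (intro nn_integral_cong) (auto simp: indicator_def)
  also have "\<dots> = ennreal (layer_mass p V g (Suc k)) + ?D"
    by (subst nn_integral_add) (simp_all only: layer_mass_eq, measurable)
  finally have eq: "ennreal (layer_mass p V g k) = ennreal (layer_mass p V g (Suc k)) + ?D" .
  then have "ennreal (layer_mass p V g (Suc k)) \<le> ennreal (layer_mass p V g k)" by simp
  then show "layer_mass p V g (Suc k) \<le> layer_mass p V g k" by (simp add: layer_mass_nonneg)
  have "?D = ennreal (layer_mass p V g k) - ennreal (layer_mass p V g (Suc k))"
    unfolding eq by simp
  then show "?D = ennreal (layer_mass p V g k - layer_mass p V g (Suc k))"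
    by (simp add: ennreal_minus layer_mass_nonneg)
qed

section \<open>Mean values of the Riesz potential over sets of finite measure\<close>

context
  fixes q v n :: real
  assumes q: "q = p / (p - 1)"
  defines "n \<equiv> real DIM('a)"
  defines "v \<equiv> unit_ball_vol n"
begin

lemma riesz_kernel_integral_le:
  fixes B :: "'a set"
  assumes [measurable]: "B \<in> sets borel" and r: "emeasure lborel B \<le> ennreal r" "0 \<le> r"
  shows "(\<integral>\<^sup>+y. ennreal (norm (x - y) powr - (n / q)) * indicator B y \<partial>lborel)
     \<le> ennreal (v powr (1 / q) * (p * r powr (1 / p)))"
proof -
  note q1 = conjugate_exponent[OF p q]
  have n: "0 < n" by (simp add: n_def)
  have eq: "n / q / n = 1 / q" "1 - 1 / q = 1 / p" using n q1 by auto
  have "n / q < n" using n q1 by (simp add: field_simps)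
  then have "(\<integral>\<^sup>+y. ennreal (norm (x - y) powr - (n / q)) * indicator B y \<partial>lborel)
     \<le> ennreal (v powr (n / q / n) / (1 - n / q / n) * r powr (1 - n / q / n))"
    using n q1 r unfolding n_def v_def by (intro nn_integral_norm_powr_le) auto
  then show ?thesis unfolding eq by (simp add: mult_ac)
qed

text \<open>The bathtub principle in \<open>y\<close> bounds the inner integral uniformly in
  \<open>x\<close>; after Tonelli's theorem it applies in \<open>x\<close> instead. The kernel
  integral dominates the smaller of the two results.\<close>

lemma riesz_kernel_double_integral_le:
  fixes E B :: "'a set"
  assumes [measurable]: "E \<in> sets borel" "B \<in> sets borel"
    and e: "emeasure lborel E = ennreal e" and r: "emeasure lborel B = ennreal r" "0 \<le> r" and t: "0 < t" "t \<le> e"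
  shows "(\<integral>\<^sup>+x. (\<integral>\<^sup>+y. ennreal (norm (x - y) powr - (n / q)) * (if x \<in> E \<and> y \<in> B then 1 else 0) \<partial>lborel) \<partial>lborel)
     \<le> ennreal (e * v powr (1 / q)) * (\<integral>\<^sup>+s. ennreal (oneil_kernel p q t s) * indicator {0<..<r} s \<partial>lborel)"
    (is "?I \<le> _")
proof -
  note q1 = conjugate_exponent[OF p q]
  have "?I = (\<integral>\<^sup>+x. (\<integral>\<^sup>+y. ennreal (norm (x - y) powr - (n / q)) * indicator B y \<partial>lborel) * indicator E x \<partial>lborel)"
    by (subst nn_integral_multc[symmetric]) (auto intro!: nn_integral_cong simp: indicator_def)
  also have "\<dots> \<le> (\<integral>\<^sup>+x. ennreal (v powr (1 / q) * (p * r powr (1 / p))) * indicator E x \<partial>lborel)"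
    using r by (intro nn_integral_mono mult_right_mono riesz_kernel_integral_le) auto
  also have "\<dots> = ennreal (v powr (1 / q) * e * (p * r powr (1 / p)))"
    using e t p by (subst nn_integral_cmult_indicator) (simp_all add: ennreal_mult'[symmetric] mult_ac)
  finally have 1: "?I \<le> ennreal (v powr (1 / q) * e * (p * r powr (1 / p)))" .
  have "?I = (\<integral>\<^sup>+y. (\<integral>\<^sup>+x. ennreal (norm (x - y) powr - (n / q)) * (if x \<in> E \<and> y \<in> B then 1 else 0) \<partial>lborel) \<partial>lborel)"
    by (rule lborel_pair.Fubini') measurable
  also have "\<dots> = (\<integral>\<^sup>+y. (\<integral>\<^sup>+x. ennreal (norm (y - x) powr - (n / q)) * indicator E x \<partial>lborel) * indicator B y \<partial>lborel)"
    by (subst nn_integral_multc[symmetric])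
       (auto intro!: nn_integral_cong simp: indicator_def norm_minus_commute)
  also have "\<dots> \<le> (\<integral>\<^sup>+y. ennreal (v powr (1 / q) * (p * e powr (1 / p))) * indicator B y \<partial>lborel)"
    using e t by (intro nn_integral_mono mult_right_mono riesz_kernel_integral_le) auto
  also have "\<dots> = ennreal (v powr (1 / q) * p * r * e powr (1 / p))"
    using r t p by (subst nn_integral_cmult_indicator) (simp_all add: ennreal_mult'[symmetric] mult_ac)
  \<comment> \<open>A factor \<open>e\<close> is split off, so that division by \<open>e\<close>
    gives a bound for the mean; in the rest \<open>e\<close> is replaced by the smaller
    \<open>t\<close>, as the exponent is negative.\<close>
  also have "\<dots> \<le> ennreal (v powr (1 / q) * p * r * (e * t powr (- 1 / q)))"
  proof (intro ennreal_leI mult_left_mono)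
    have "1 / p = 1 + (- 1 / q)" using q1 by simp
    then have "e powr (1 / p) = e * e powr (- 1 / q)" using t powr_add[of e 1 "- 1 / q"] by simp
    also have "\<dots> \<le> e * t powr (- 1 / q)" using t q1 by (intro mult_left_mono powr_mono2') auto
    finally show "e powr (1 / p) \<le> e * t powr (- 1 / q)" .
  qed (use p r in auto)
  finally have 2: "?I \<le> ennreal (v powr (1 / q) * p * r * (e * t powr (- 1 / q)))" .
  have "?I \<le> ennreal (e * v powr (1 / q) * min (p * r powr (1 / p)) (p * r * t powr (- 1 / q)))"
  proof (cases "p * r powr (1 / p) \<le> p * r * t powr (- 1 / q)")
    case True
    then show ?thesis using 1 by (simp add: min_def mult_ac)
  next
    case False
    then show ?thesis using 2 by (simp add: min_def mult_ac)
  qed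
  also have "\<dots> = ennreal (e * v powr (1 / q)) * ennreal (min (p * r powr (1 / p)) (p * r * t powr (- 1 / q)))"
    using t by (simp add: ennreal_mult')
  also have "\<dots> \<le> ennreal (e * v powr (1 / q)) * (\<integral>\<^sup>+s. ennreal (oneil_kernel p q t s) * indicator {0<..<r} s \<partial>lborel)"
    by (intro mult_left_mono min_le_nn_integral_oneil_kernel p q t r) auto
  finally show ?thesis .
qed

text \<open>The layer cake in \<open>g\<close> reduces this to superlevel sets. Integrated over the
  levels, the condition \<open>s < distribution_fun g \<tau>\<close> gives back
  \<open>decreasing_rearrangement g s\<close>. The case \<open>t < e\<close> is included because it
  is applied to a set assumed to be too large.\<close>

lemma oneil_inequality:
  fixes E :: "'a set"
  assumes [measurable]: "E \<in> sets borel" and e: "emeasure lborel E = ennreal e" and t: "0 < t" "t \<le> e"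
  shows "(\<integral>\<^sup>+x. (\<integral>\<^sup>+y. ennreal (norm (x - y) powr - (n / q) * g y) \<partial>lborel) * indicator E x \<partial>lborel)
     \<le> ennreal (e * v powr (1 / q)) *
       (\<integral>\<^sup>+s. ennreal (oneil_kernel p q t s * decreasing_rearrangement g s) * indicator {0<..} s \<partial>lborel)"
proof -
  let ?K = "\<lambda>x y. ennreal (norm (x - y) powr - (n / q))"
  have layer: "ennreal (g y) = (\<integral>\<^sup>+\<tau>. (if 0 < \<tau> \<and> \<tau> < g y then 1 else 0) \<partial>lborel)" for y
  proof -
    have "(\<integral>\<^sup>+\<tau>. (if 0 < \<tau> \<and> \<tau> < g y then 1 else 0) \<partial>lborel) = (\<integral>\<^sup>+\<tau>. indicator {0<..<g y} \<tau> \<partial>lborel)"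
      by (intro nn_integral_cong) (auto simp: indicator_def)
    then show ?thesis using g0 by simp
  qed
  have "(\<integral>\<^sup>+x. (\<integral>\<^sup>+y. ennreal (norm (x - y) powr - (n / q) * g y) \<partial>lborel) * indicator E x \<partial>lborel) =
     (\<integral>\<^sup>+x. (\<integral>\<^sup>+y. (\<integral>\<^sup>+\<tau>. ?K x y * (if x \<in> E \<and> 0 < \<tau> \<and> \<tau> < g y then 1 else 0) \<partial>lborel) \<partial>lborel) \<partial>lborel)"
  proof (intro nn_integral_cong)
    fix x
    have "(\<integral>\<^sup>+y. ennreal (norm (x - y) powr - (n / q) * g y) \<partial>lborel) * indicator E x =
      (\<integral>\<^sup>+y. ?K x y * (\<integral>\<^sup>+\<tau>. (if 0 < \<tau> \<and> \<tau> < g y then 1 else 0) \<partial>lborel) * indicator E x \<partial>lborel)"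
      by (simp add: nn_integral_multc ennreal_mult' layer[symmetric] g0)
    also have "\<dots> = (\<integral>\<^sup>+y. (\<integral>\<^sup>+\<tau>. ?K x y * (if x \<in> E \<and> 0 < \<tau> \<and> \<tau> < g y then 1 else 0) \<partial>lborel) \<partial>lborel)"
      by (cases "x \<in> E") (simp_all add: nn_integral_cmult)
    finally show "(\<integral>\<^sup>+y. ennreal (norm (x - y) powr - (n / q) * g y) \<partial>lborel) * indicator E x = \<dots>" .
  qed
  also have "\<dots> = (\<integral>\<^sup>+x. (\<integral>\<^sup>+\<tau>. (\<integral>\<^sup>+y. ?K x y * (if x \<in> E \<and> 0 < \<tau> \<and> \<tau> < g y then 1 else 0) \<partial>lborel) \<partial>lborel) \<partial>lborel)"
    by (intro nn_integral_cong lborel_pair.Fubini') measurable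
  also have "\<dots> = (\<integral>\<^sup>+\<tau>. (\<integral>\<^sup>+x. (\<integral>\<^sup>+y. ?K x y * (if x \<in> E \<and> 0 < \<tau> \<and> \<tau> < g y then 1 else 0) \<partial>lborel) \<partial>lborel) \<partial>lborel)"
    by (intro lborel_pair.Fubini') measurable
  also have "\<dots> \<le> (\<integral>\<^sup>+\<tau>. ennreal (e * v powr (1 / q)) *
      (\<integral>\<^sup>+s. ennreal (oneil_kernel p q t s) * (if 0 < \<tau> \<and> 0 < s \<and> s < distribution_fun g \<tau> then 1 else 0) \<partial>lborel) \<partial>lborel)"
  proof (intro nn_integral_mono)
    fix \<tau> :: real
    show "(\<integral>\<^sup>+x. (\<integral>\<^sup>+y. ?K x y * (if x \<in> E \<and> 0 < \<tau> \<and> \<tau> < g y then 1 else 0) \<partial>lborel) \<partial>lborel) \<le>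
       ennreal (e * v powr (1 / q)) *
      (\<integral>\<^sup>+s. ennreal (oneil_kernel p q t s) * (if 0 < \<tau> \<and> 0 < s \<and> s < distribution_fun g \<tau> then 1 else 0) \<partial>lborel)"
    proof (cases "0 < \<tau>")
      case True
      have "(\<integral>\<^sup>+s. ennreal (oneil_kernel p q t s) * (if 0 < s \<and> s < distribution_fun g \<tau> then 1 else 0) \<partial>lborel) =
         (\<integral>\<^sup>+s. ennreal (oneil_kernel p q t s) * indicator {0<..<distribution_fun g \<tau>} s \<partial>lborel)"
        by (intro nn_integral_cong) (auto simp: indicator_def)
      then show ?thesis
        using True riesz_kernel_double_integral_le[of E "{y. \<tau> < g y}", OF _ _ e emeasure_superlevel[OF True] distribution_fun_nonneg t]
        by simp
    qed auto
  qed
  also have "\<dots> = ennreal (e * v powr (1 / q)) * (\<integral>\<^sup>+\<tau>.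
      (\<integral>\<^sup>+s. ennreal (oneil_kernel p q t s) * (if 0 < \<tau> \<and> 0 < s \<and> s < distribution_fun g \<tau> then 1 else 0) \<partial>lborel) \<partial>lborel)"
    by (rule nn_integral_cmult) measurable
  also have "(\<integral>\<^sup>+\<tau>. (\<integral>\<^sup>+s. ennreal (oneil_kernel p q t s) * (if 0 < \<tau> \<and> 0 < s \<and> s < distribution_fun g \<tau> then 1 else 0) \<partial>lborel) \<partial>lborel) =
      (\<integral>\<^sup>+s. (\<integral>\<^sup>+\<tau>. ennreal (oneil_kernel p q t s) * (if 0 < \<tau> \<and> 0 < s \<and> s < distribution_fun g \<tau> then 1 else 0) \<partial>lborel) \<partial>lborel)"
    by (intro lborel_pair.Fubini') measurable
  also have "\<dots> = (\<integral>\<^sup>+s. ennreal (oneil_kernel p q t s * decreasing_rearrangement g s) * indicator {0<..} s \<partial>lborel)"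
  proof (intro nn_integral_cong)
    fix s :: real
    show "(\<integral>\<^sup>+\<tau>. ennreal (oneil_kernel p q t s) * (if 0 < \<tau> \<and> 0 < s \<and> s < distribution_fun g \<tau> then 1 else 0) \<partial>lborel) =
      ennreal (oneil_kernel p q t s * decreasing_rearrangement g s) * indicator {0<..} s"
    proof (cases "0 < s")
      case True
      have "(\<integral>\<^sup>+\<tau>. ennreal (oneil_kernel p q t s) * (if 0 < \<tau> \<and> 0 < s \<and> s < distribution_fun g \<tau> then 1 else 0) \<partial>lborel) =
        (\<integral>\<^sup>+\<tau>. ennreal (oneil_kernel p q t s) * indicator {\<tau>. 0 < \<tau> \<and> s < distribution_fun g \<tau>} \<tau> \<partial>lborel)"
        using True by (intro nn_integral_cong) (auto simp: indicator_def)
      also have "\<dots> = ennreal (oneil_kernel p q t s) * ennreal (decreasing_rearrangement g s)"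
        using True by (simp add: nn_integral_cmult_indicator emeasure_superlevel_distribution)
      finally show ?thesis using True p by (simp add: ennreal_mult' oneil_kernel_nonneg)
    qed auto
  qed
  finally show ?thesis .
qed

text \<open>On \<open>(0, t k]\<close> the kernel is constant, and after Hoelder's inequality the
  powers of \<open>t k\<close> cancel. Each of the \<open>k\<close> layers between
  \<open>t k\<close> and \<open>V\<close> contributes one decrement, and beyond \<open>V\<close> the
  rearrangement vanishes.\<close>

lemma nn_integral_oneil_kernel_le:
  "(\<integral>\<^sup>+s. ennreal (oneil_kernel p q (V * exp (- real k)) s * decreasing_rearrangement g s) * indicator {0<..} s \<partial>lborel)
    \<le> ennreal (adams_bound p (layer_mass p V g) k)"
proof -
  note q1 = conjugate_exponent[OF p q]
  define t where "t j = V * exp (- real j)" for j :: nat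
  define f where "f = decreasing_rearrangement g"
  have f0: "0 \<le> f s" for s by (simp add: f_def decreasing_rearrangement_nonneg)
  have [measurable]: "f \<in> borel_measurable borel" by (simp add: f_def)
  have t0: "0 < t j" for j using V(1) by (simp add: t_def)
  have head: "(\<integral>\<^sup>+s. ennreal (p * t k powr (- 1 / q) * (indicator {0<..t k} s * (f s * indicator {0<..t k} s))) \<partial>lborel)
      \<le> ennreal (p * layer_mass p V g k powr (1 / p))"
  proof -
    have "(\<integral>\<^sup>+s. ennreal (p * t k powr (- 1 / q) * (indicator {0<..t k} s * (f s * indicator {0<..t k} s))) \<partial>lborel)
       = ennreal (p * t k powr (- 1 / q)) * (\<integral>\<^sup>+s. ennreal (indicator {0<..t k} s * (f s * indicator {0<..t k} s)) \<partial>lborel)"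
      using p f0 by (subst nn_integral_cmult[symmetric]) (auto simp: ennreal_mult')
    also have "\<dots> \<le> ennreal (p * t k powr (- 1 / q)) * ennreal (t k powr (1 / q) * layer_mass p V g k powr (1 / p))"
    proof (intro mult_left_mono nn_integral_Holder[OF p q])
      have "(\<integral>\<^sup>+s. ennreal (indicator {0<..t k} s powr q) \<partial>lborel) = (\<integral>\<^sup>+s. indicator {0<..t k} s \<partial>lborel)"
        by (intro nn_integral_cong) (auto simp: indicator_def)
      then show "(\<integral>\<^sup>+s. ennreal (indicator {0<..t k} s powr q) \<partial>lborel) \<le> ennreal (t k)"
        using t0[of k] by simp
      have "(\<integral>\<^sup>+s. ennreal ((f s * indicator {0<..t k} s) powr p) \<partial>lborel) = ennreal (layer_mass p V g k)"
        unfolding layer_mass_eq[symmetric] by (intro nn_integral_cong) (auto simp: indicator_def f_def t_def)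
      then show "(\<integral>\<^sup>+s. ennreal ((f s * indicator {0<..t k} s) powr p) \<partial>lborel) \<le> ennreal (layer_mass p V g k)" by simp
    qed (use f0 t0[of k] layer_mass_nonneg in auto)
    also have "\<dots> = ennreal (p * layer_mass p V g k powr (1 / p))"
      using p t0[of k] by (simp add: ennreal_mult'[symmetric] powr_minus)
    finally show ?thesis .
  qed
  have piece: "(\<integral>\<^sup>+s. ennreal (s powr (- 1 / q) * indicator {t (Suc j)<..t j} s * (f s * indicator {t (Suc j)<..t j} s)) \<partial>lborel)
      \<le> ennreal ((layer_mass p V g j - layer_mass p V g (Suc j)) powr (1 / p))" for j
  proof -
    have le: "t (Suc j) \<le> t j" using V(1) by (simp add: t_def)
    have "(\<integral>\<^sup>+s. ennreal (s powr (- 1 / q) * indicator {t (Suc j)<..t j} s * (f s * indicator {t (Suc j)<..t j} s)) \<partial>lborel)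
      \<le> ennreal (1 powr (1 / q) * (layer_mass p V g j - layer_mass p V g (Suc j)) powr (1 / p))"
    proof (intro nn_integral_Holder[OF p q])
      have "(\<integral>\<^sup>+s. ennreal ((s powr (- 1 / q) * indicator {t (Suc j)<..t j} s) powr q) \<partial>lborel)
          \<le> (\<integral>\<^sup>+s. ennreal (inverse s) * indicator {t (Suc j)..t j} s \<partial>lborel)"
      proof (intro nn_integral_mono)
        fix s :: real
        have "(s powr (- 1 / q)) powr q = inverse s" if "0 < s"
        proof -
          have "(s powr (- 1 / q)) powr q = s powr - 1" using q1 by (simp add: powr_powr)
          then show ?thesis using that by (simp add: powr_minus)
        qed
        then show "ennreal ((s powr (- 1 / q) * indicator {t (Suc j)<..t j} s) powr q) \<le>
            ennreal (inverse s) * indicator {t (Suc j)..t j} s"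
          using t0[of "Suc j"] by (cases "s \<in> {t (Suc j)<..t j}") auto
      qed
      also have "\<dots> = ennreal (ln (t j) - ln (t (Suc j)))"
        using t0[of "Suc j"] le by (intro nn_integral_FTC_Icc) (auto intro!: derivative_eq_intros simp: inverse_eq_divide)
      also have "ln (t j) - ln (t (Suc j)) = 1" using V(1) by (simp add: t_def ln_mult)
      finally show "(\<integral>\<^sup>+s. ennreal ((s powr (- 1 / q) * indicator {t (Suc j)<..t j} s) powr q) \<partial>lborel) \<le> ennreal 1" .
      have "(\<integral>\<^sup>+s. ennreal ((f s * indicator {t (Suc j)<..t j} s) powr p) \<partial>lborel) =
          ennreal (layer_mass p V g j - layer_mass p V g (Suc j))"
        unfolding layer_mass_diff[symmetric] by (intro nn_integral_cong) (auto simp: indicator_def f_def t_def)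
      then show "(\<integral>\<^sup>+s. ennreal ((f s * indicator {t (Suc j)<..t j} s) powr p) \<partial>lborel) \<le>
          ennreal (layer_mass p V g j - layer_mass p V g (Suc j))" by simp
    qed (use f0 layer_mass_Suc_le in auto)
    then show ?thesis by simp
  qed
  have "(\<integral>\<^sup>+s. ennreal (oneil_kernel p q (t k) s * f s) * indicator {0<..} s \<partial>lborel) \<le>
    (\<integral>\<^sup>+s. ennreal (p * t k powr (- 1 / q) * (indicator {0<..t k} s * (f s * indicator {0<..t k} s))) +
      (\<Sum>j<k. ennreal (s powr (- 1 / q) * indicator {t (Suc j)<..t j} s * (f s * indicator {t (Suc j)<..t j} s))) \<partial>lborel)"
  proof (intro nn_integral_mono)
    fix s :: real
    consider "s \<le> 0" | "0 < s" "s \<le> t k" | "t k < s" "s \<le> V" | "V < s" by linarith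
    then show "ennreal (oneil_kernel p q (t k) s * f s) * indicator {0<..} s \<le>
      ennreal (p * t k powr (- 1 / q) * (indicator {0<..t k} s * (f s * indicator {0<..t k} s))) +
      (\<Sum>j<k. ennreal (s powr (- 1 / q) * indicator {t (Suc j)<..t j} s * (f s * indicator {t (Suc j)<..t j} s)))"
    proof cases
      case 2
      then show ?thesis by (simp add: oneil_kernel_def add_increasing2)
    next
      case 3
      \<comment> \<open>The first \<open>t i\<close> below \<open>s\<close> is the lower end of the
        layer containing \<open>s\<close>; \<open>i\<close> is not 0 because
        \<open>t 0 = V\<close>.\<close>
      define i where "i = (LEAST i. t i < s)"
      have i: "t i < s" "i \<le> k" unfolding i_def using 3 by (auto intro: LeastI Least_le)
      have "i \<noteq> 0" using i 3 by (intro notI) (simp add: t_def)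
      then obtain j where j: "i = Suc j" by (cases i) auto
      have "s \<le> t j" using not_less_Least[of j "\<lambda>i. t i < s"] j by (simp add: i_def[symmetric] not_less)
      then have "ennreal (oneil_kernel p q (t k) s * f s) * indicator {0<..} s \<le>
        ennreal (s powr (- 1 / q) * indicator {t (Suc j)<..t j} s * (f s * indicator {t (Suc j)<..t j} s))"
        using 3 i j t0[of k] by (simp add: oneil_kernel_def)
      also have "\<dots> \<le> (\<Sum>j<k. ennreal (s powr (- 1 / q) * indicator {t (Suc j)<..t j} s * (f s * indicator {t (Suc j)<..t j} s)))"
        using i j by (intro member_le_sum) auto
      finally show ?thesis by (rule add_increasing[rotated]) simp
    qed (auto simp: f_def decreasing_rearrangement_eq_0)
  qed
  also have "\<dots> = (\<integral>\<^sup>+s. ennreal (p * t k powr (- 1 / q) * (indicator {0<..t k} s * (f s * indicator {0<..t k} s))) \<partial>lborel) +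
      (\<Sum>j<k. \<integral>\<^sup>+s. ennreal (s powr (- 1 / q) * indicator {t (Suc j)<..t j} s * (f s * indicator {t (Suc j)<..t j} s)) \<partial>lborel)"
    by (simp add: nn_integral_add nn_integral_sum)
  also have "\<dots> \<le> ennreal (p * layer_mass p V g k powr (1 / p)) +
      (\<Sum>j<k. ennreal ((layer_mass p V g j - layer_mass p V g (Suc j)) powr (1 / p)))"
    by (intro add_mono head sum_mono piece)
  also have "\<dots> = ennreal (adams_bound p (layer_mass p V g) k)"
    using p by (simp add: adams_bound_def sum_ennreal sum_nonneg)
  finally show ?thesis by (simp add: t_def f_def)
qed

text \<open>If the set were larger, the potential would exceed the threshold in the mean over it,
  contrary to O'Neil's inequality with \<open>t = V * exp (- k)\<close>.\<close>

lemma emeasure_riesz_superlevel_le: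
  fixes \<Omega> :: "'a set"
  assumes [measurable]: "\<Omega> \<in> sets borel" and \<Omega>: "emeasure lborel \<Omega> = ennreal V"
  shows "emeasure lborel {x \<in> \<Omega>. ennreal (v powr (1 / q) * adams_bound p (layer_mass p V g) k)
      < (\<integral>\<^sup>+y. ennreal (norm (x - y) powr - (n / q) * g y) \<partial>lborel)} \<le> ennreal (V * exp (- real k))"
proof (rule ccontr)
  define N where "N x = (\<integral>\<^sup>+y. ennreal (norm (x - y) powr - (n / q) * g y) \<partial>lborel)" for x
  have [measurable]: "N \<in> borel_measurable borel" unfolding N_def by measurable
  define U where "U = v powr (1 / q) * adams_bound p (layer_mass p V g) k"
  define E where "E = {x \<in> \<Omega>. ennreal U < N x}"
  have E[measurable]: "E \<in> sets borel" unfolding E_def by measurable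
  assume "\<not> ?thesis"
  then have big: "ennreal (V * exp (- real k)) < emeasure lborel E" by (simp add: E_def N_def U_def)
  have "emeasure lborel E \<le> emeasure lborel \<Omega>" by (intro emeasure_mono) (auto simp: E_def)
  then have "emeasure lborel E < \<infinity>" unfolding \<Omega> by (simp add: le_less_trans)
  then obtain e where e: "emeasure lborel E = ennreal e" "0 \<le> e" by (cases "emeasure lborel E") auto
  have te: "0 < V * exp (- real k)" "V * exp (- real k) < e"
    using big e V(1) by (auto simp: ennreal_less_iff)
  have U0: "0 \<le> U" using p by (simp add: U_def adams_bound_nonneg)
  have "ennreal (U * e) = (\<integral>\<^sup>+x. ennreal U * indicator E x \<partial>lborel)"
    using U0 e by (simp add: nn_integral_cmult_indicator ennreal_mult)
  also have "\<dots> < (\<integral>\<^sup>+x. N x * indicator E x \<partial>lborel)"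
  proof (rule nn_integral_less)
    show "(\<integral>\<^sup>+x. ennreal U * indicator E x \<partial>lborel) \<noteq> \<infinity>"
      using e by (simp add: nn_integral_cmult_indicator ennreal_mult_eq_top_iff)
    show "AE x in lborel. ennreal U * indicator E x \<le> N x * indicator E x"
      by (auto simp: indicator_def E_def)
    show "\<not> (AE x in lborel. N x * indicator E x \<le> ennreal U * indicator E x)"
    proof
      assume "AE x in lborel. N x * indicator E x \<le> ennreal U * indicator E x"
      then have "AE x in lborel. x \<notin> E"
        by eventually_elim (auto simp: indicator_def E_def)
      then have "emeasure lborel E = 0" by (subst (asm) AE_iff_measurable[of E]) auto
      then show False using e te by simp
    qed
  qed auto
  also have "\<dots> \<le> ennreal (e * v powr (1 / q)) * ennreal (adams_bound p (layer_mass p V g) k)"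
    unfolding N_def using te nn_integral_oneil_kernel_le[of k]
    by (intro order.trans[OF oneil_inequality[OF E e(1) te(1)]] mult_left_mono) auto
  also have "\<dots> = ennreal (U * e)" using e p by (simp add: U_def ennreal_mult[symmetric] adams_bound_nonneg mult_ac)
  finally show False by simp
qed

section \<open>The exponential integral\<close>

text \<open>Points of the domain are sorted by the first \<open>i\<close> at which the potential is
  at most \<open>U i\<close>. There the exponential is at most \<open>exp (d * X i powr q)\<close>,
  and for \<open>i > 0\<close> the point lies in \<open>B (i - 1)\<close>, whose weighted measure is
  at most a multiple of \<open>exp (- (d * i))\<close>.\<close>

lemma nn_integral_exp_riesz_le:
  fixes \<Omega> :: "'a set" and u :: "'a \<Rightarrow> real" and \<alpha> C :: real
  defines "d \<equiv> 1 - \<alpha> / n"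
  assumes \<Omega>_borel [measurable]: "\<Omega> \<in> sets borel" and \<Omega>: "emeasure lborel \<Omega> = ennreal V"
    and \<alpha>: "0 \<le> \<alpha>" "\<alpha> < n"
    and u: "\<And>x. ennreal \<bar>u x\<bar> \<le> (\<integral>\<^sup>+y. ennreal (norm (x - y) powr - (n / q) * g y) \<partial>lborel)"
    and C: "(\<Sum>k. ennreal (exp (d * (adams_bound p (layer_mass p V g) k powr q - real k)))) \<le> ennreal C"
  shows "(\<integral>\<^sup>+x\<in>\<Omega>. ennreal (exp (d / v * \<bar>u x\<bar> powr q) / norm x powr \<alpha>) \<partial>lborel)
    \<le> ennreal (v powr (\<alpha> / n) / d * V powr d * exp d) * ennreal C"
proof -
  note q1 = conjugate_exponent[OF p q]
  have n: "0 < n" by (simp add: n_def)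
  have v: "0 < v" using n by (simp add: v_def)
  have d: "0 < d" using \<alpha> n by (simp add: d_def field_simps)
  define X where "X = adams_bound p (layer_mass p V g)"
  have X0: "0 \<le> X k" for k using p by (simp add: X_def adams_bound_nonneg)
  define U where "U k = v powr (1 / q) * X k" for k
  define N where "N x = (\<integral>\<^sup>+y. ennreal (norm (x - y) powr - (n / q) * g y) \<partial>lborel)" for x
  have [measurable]: "N \<in> borel_measurable borel" unfolding N_def by measurable
  define B where "B k = {x \<in> \<Omega>. ennreal (U k) < N x}" for k
  have B[measurable]: "B k \<in> sets borel" for k unfolding B_def by measurable
  have B_le: "emeasure lborel (B k) \<le> ennreal (V * exp (- real k))" for k
    using emeasure_riesz_superlevel_le[OF \<Omega>_borel \<Omega>, of k] by (simp add: B_def U_def X_def N_def)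
  \<comment> \<open>At the origin this and the quotient in the integrand are both 0, by the
    conventions for \<open>powr\<close> and for division.\<close>
  define w where "w x = ennreal (norm x powr - \<alpha>)" for x :: 'a
  have [measurable]: "w \<in> borel_measurable borel" unfolding w_def by measurable
  define W where "W = v powr (\<alpha> / n) / d"
  have W: "0 \<le> W" using d by (simp add: W_def)
  \<comment> \<open>The bathtub principle centred at the origin.\<close>
  have w_le: "(\<integral>\<^sup>+x. w x * indicator A x \<partial>lborel) \<le> ennreal (W * r powr d)"
    if "A \<in> sets borel" "emeasure lborel A \<le> ennreal r" "0 \<le> r" for A r
    using nn_integral_norm_powr_le[of \<alpha> A r 0] that \<alpha> by (simp add: w_def W_def d_def n_def v_def)
  have pointwise: "exp (d / v * \<bar>u x\<bar> powr q) / norm x powr \<alpha> \<le> exp (d * X k powr q) * norm x powr - \<alpha>"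
    if "N x \<le> ennreal (U k)" for x k
  proof -
    have "ennreal \<bar>u x\<bar> \<le> ennreal (U k)" using u[of x] that by (simp add: N_def)
    then have "\<bar>u x\<bar> \<le> U k" using X0 by (subst (asm) ennreal_le_iff) (auto simp: U_def)
    then have "\<bar>u x\<bar> powr q \<le> U k powr q" using q1 by (intro powr_mono2) auto
    also have "\<dots> = v * X k powr q" using q1 v X0 by (simp add: U_def powr_mult powr_powr)
    finally have "d / v * \<bar>u x\<bar> powr q \<le> d / v * (v * X k powr q)"
      using d v by (intro mult_left_mono) auto
    then have "exp (d / v * \<bar>u x\<bar> powr q) \<le> exp (d * X k powr q)" using v by simp
    then show ?thesis by (simp add: powr_minus_divide divide_right_mono)
  qed
  have null: "AE x in lborel. x \<notin> (\<Inter>k. B k)"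
  proof (rule AE_not_in)
    have "emeasure lborel (\<Inter>k. B k) \<le> ennreal (V * exp (- real k))" for k
      using B_le[of k] emeasure_mono[of "\<Inter>k. B k" "B k" lborel] by (auto intro: order.trans)
    moreover have "(\<lambda>k. ennreal (V * exp (- real k))) \<longlonglongrightarrow> ennreal (V * 0)"
      by (intro tendsto_ennrealI tendsto_mult tendsto_const)
         (auto intro: filterlim_compose[OF exp_at_bot] simp: filterlim_uminus_at_bot filterlim_real_sequentially)
    ultimately have "emeasure lborel (\<Inter>k. B k) \<le> ennreal (V * 0)"
      by (intro tendsto_lowerbound[where F = sequentially]) auto
    then show "(\<Inter>k. B k) \<in> null_sets lborel" by (auto simp: null_sets_def)
  qed
  \<comment> \<open>The separate term serves the points outside \<open>B 0\<close>, the term with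
    index \<open>k\<close> those with first index \<open>Suc k\<close>.\<close>
  have "(\<integral>\<^sup>+x\<in>\<Omega>. ennreal (exp (d / v * \<bar>u x\<bar> powr q) / norm x powr \<alpha>) \<partial>lborel) \<le>
    (\<integral>\<^sup>+x. ennreal (exp (d * X 0 powr q)) * (w x * indicator \<Omega> x) +
      (\<Sum>k. ennreal (exp (d * X (Suc k) powr q)) * (w x * indicator (B k) x)) \<partial>lborel)"
  proof (intro nn_integral_mono_AE)
    from null show "AE x in lborel. ennreal (exp (d / v * \<bar>u x\<bar> powr q) / norm x powr \<alpha>) * indicator \<Omega> x \<le>
      ennreal (exp (d * X 0 powr q)) * (w x * indicator \<Omega> x) +
      (\<Sum>k. ennreal (exp (d * X (Suc k) powr q)) * (w x * indicator (B k) x))"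
    proof eventually_elim
      fix x assume x: "x \<notin> (\<Inter>k. B k)"
      let ?E = "ennreal (exp (d / v * \<bar>u x\<bar> powr q) / norm x powr \<alpha>)"
      have bd: "?E \<le> ennreal (exp (d * X k powr q)) * w x" if "N x \<le> ennreal (U k)" for k
        using ennreal_leI[OF pointwise[OF that]] by (simp add: w_def ennreal_mult')
      show "?E * indicator \<Omega> x \<le> ennreal (exp (d * X 0 powr q)) * (w x * indicator \<Omega> x) +
        (\<Sum>k. ennreal (exp (d * X (Suc k) powr q)) * (w x * indicator (B k) x))"
      proof (cases "x \<in> \<Omega>")
        case True
        define i where "i = (LEAST k. x \<notin> B k)"
        have i: "x \<notin> B i" unfolding i_def using x LeastI_ex[of "\<lambda>k. x \<notin> B k"] by blast
        then have Ni: "N x \<le> ennreal (U i)" using True by (auto simp: B_def not_less)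
        show ?thesis
        proof (cases i)
          case 0
          then show ?thesis using bd[OF Ni] True by (simp add: add_increasing2)
        next
          case (Suc k)
          have "x \<in> B k" using not_less_Least[of k "\<lambda>k. x \<notin> B k"] Suc by (simp add: i_def[symmetric])
          then have "?E * indicator \<Omega> x \<le> ennreal (exp (d * X (Suc k) powr q)) * (w x * indicator (B k) x)"
            using bd[OF Ni] True Suc by simp
          also have "\<dots> \<le> (\<Sum>k. ennreal (exp (d * X (Suc k) powr q)) * (w x * indicator (B k) x))"
            by (rule ennreal_le_suminf)
          finally show ?thesis by (rule add_increasing[rotated]) simp
        qed
      qed simp
    qed
  qed
  also have "\<dots> = ennreal (exp (d * X 0 powr q)) * (\<integral>\<^sup>+x. w x * indicator \<Omega> x \<partial>lborel) +
      (\<Sum>k. ennreal (exp (d * X (Suc k) powr q)) * (\<integral>\<^sup>+x. w x * indicator (B k) x \<partial>lborel))"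
    by (simp add: nn_integral_add nn_integral_suminf nn_integral_cmult)
  also have "\<dots> \<le> ennreal (exp (d * X 0 powr q)) * ennreal (W * V powr d) +
      (\<Sum>k. ennreal (exp (d * X (Suc k) powr q)) * ennreal (W * (V * exp (- real k)) powr d))"
    using V B_le \<Omega> by (intro add_mono suminf_le mult_left_mono w_le) auto
  \<comment> \<open>The measure bound carries \<open>k\<close> where the exponential carries
    \<open>Suc k\<close>. The factor \<open>exp d\<close> pays for the shift; granted to the
    separate term as well, it lets both parts join to one series.\<close>
  also have "\<dots> \<le> ennreal (W * V powr d * exp d) * ennreal (exp (d * (X 0 powr q - real 0))) +
      (\<Sum>k. ennreal (W * V powr d * exp d) * ennreal (exp (d * (X (Suc k) powr q - real (Suc k)))))"
  proof (intro add_mono suminf_le)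
    have "exp (d * X 0 powr q) * (W * V powr d) \<le> exp d * (exp (d * X 0 powr q) * (W * V powr d))"
      using d W by (intro mult_right_mono[of 1 "exp d", simplified]) auto
    then show "ennreal (exp (d * X 0 powr q)) * ennreal (W * V powr d) \<le>
        ennreal (W * V powr d * exp d) * ennreal (exp (d * (X 0 powr q - real 0)))"
      using W by (simp add: ennreal_mult'[symmetric] mult_ac)
    fix k
    have "(V * exp (- real k)) powr d = V powr d * exp (- (d * real k))"
      using V(1) by (simp add: powr_mult exp_powr_real mult.commute)
    moreover have "d * X (Suc k) powr q + - (d * real k) = d + d * (X (Suc k) powr q - real (Suc k))"
      by (simp add: algebra_simps)
    then have "exp (d * X (Suc k) powr q) * exp (- (d * real k)) = exp d * exp (d * (X (Suc k) powr q - real (Suc k)))"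
      by (simp only: exp_add[symmetric])
    ultimately have "exp (d * X (Suc k) powr q) * (W * (V * exp (- real k)) powr d) =
        W * V powr d * exp d * exp (d * (X (Suc k) powr q - real (Suc k)))"
      by (simp only: mult_ac)
    then have "ennreal (exp (d * X (Suc k) powr q) * (W * (V * exp (- real k)) powr d)) =
        ennreal (W * V powr d * exp d * exp (d * (X (Suc k) powr q - real (Suc k))))"
      by (rule arg_cong)
    then show "ennreal (exp (d * X (Suc k) powr q)) * ennreal (W * (V * exp (- real k)) powr d) \<le>
        ennreal (W * V powr d * exp d) * ennreal (exp (d * (X (Suc k) powr q - real (Suc k))))"
      using W by (simp only: ennreal_mult'[symmetric] ennreal_mult''[symmetric] powr_ge_zero exp_ge_zero mult_nonneg_nonneg order.refl)
  qed auto
  also have "\<dots> = ennreal (W * V powr d * exp d) * (\<Sum>k. ennreal (exp (d * (X k powr q - real k))))"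
    by (simp only: ennreal_suminf_cmult distrib_left[symmetric])
       (subst suminf_offset[of "\<lambda>k. ennreal (exp (d * (X k powr q - real k)))" 1], auto simp: add.commute)
  also have "\<dots> \<le> ennreal (W * V powr d * exp d) * ennreal C"
    using C by (intro mult_left_mono) (auto simp: X_def)
  finally show ?thesis by (simp add: W_def)
qed

end

end

section \<open>Reduction to a normalised Borel function\<close>

text \<open>A nonintegrable function has the default integral 0, so the points where the potential
  is not defined are covered as well.\<close>

lemma ennreal_norm_integral_le:
  fixes f :: "'a \<Rightarrow> 'b::{banach, second_countable_topology}"
  shows "ennreal (norm (integral\<^sup>L M f)) \<le> (\<integral>\<^sup>+x. ennreal (norm (f x)) \<partial>M)"
  by (cases "integrable M f") (auto simp: integral_norm_bound_ennreal not_integrable_integral_eq)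

text \<open>The union in the definition of the support may be uncountable; Lindeloef's theorem
  provides a countable subfamily with the same union.\<close>

lemma AE_eq_0_outside_ess_support:
  fixes f :: "'a::euclidean_space \<Rightarrow> real"
  shows "AE x in lebesgue. x \<notin> ess_support f \<longrightarrow> f x = 0"
proof -
  define F where "F = {U. open U \<and> (AE x in lebesgue. x \<in> U \<longrightarrow> f x = 0)}"
  obtain F' where F': "F' \<subseteq> F" "countable F'" "\<Union>F' = \<Union>F"
    using Lindelof[of F] by (auto simp: F_def)
  have "AE x in lebesgue. \<forall>U\<in>F'. x \<in> U \<longrightarrow> f x = 0"
    using F' by (subst AE_ball_countable) (auto simp: F_def)
  then show ?thesis
    by eventually_elim (use F'(3) in \<open>auto simp: ess_support_def F_def[symmetric]\<close>)
qed

text \<open>The functional equation of Gamma. It turns the factor in the exponent of the theorem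
  into the reciprocal of the volume of the unit ball.\<close>

lemma unit_sphere_area_eq: "0 < n \<Longrightarrow> unit_sphere_area n = real n * unit_ball_vol (real n)"
proof -
  assume "0 < n"
  moreover from this have "Gamma (real n / 2 + 1) = real n / 2 * Gamma (real n / 2)"
    by (intro Gamma_plus1) (auto simp: nonpos_Ints_def)
  ultimately show ?thesis by (simp only: unit_sphere_area_def unit_ball_vol_def) simp
qed

lemma integral_powr_pos:
  assumes f: "f \<in> Lp p" "\<not> (AE x in lebesgue. f x = 0)"
  shows "0 < (LINT x|lebesgue. \<bar>f x\<bar> powr p)"
proof -
  have "(LINT x|lebesgue. \<bar>f x\<bar> powr p) \<noteq> 0"
    using f by (subst integral_nonneg_eq_0_iff_AE) (auto simp: Lp_def)
  moreover have "0 \<le> (LINT x|lebesgue. \<bar>f x\<bar> powr p)" by simp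
  ultimately show ?thesis by linarith
qed

text \<open>The Borel representative of \<open>\<bar>f\<bar> / \<parallel>f\<parallel>\<^sub>p\<close> makes the Tonelli arguments applicable.\<close>

lemma normalized_representative:
  fixes f :: "'a::euclidean_space \<Rightarrow> real"
  assumes p: "0 < p" and f: "f \<in> Lp p" "\<not> (AE x in lebesgue. f x = 0)" "ess_support f \<subseteq> \<Omega>" and "open \<Omega>"
  obtains g where "g \<in> borel_measurable borel" "\<And>y. 0 \<le> g y" "\<And>y. y \<notin> \<Omega> \<Longrightarrow> g y = 0"
    "(\<integral>\<^sup>+y. ennreal (g y powr p) \<partial>lborel) \<le> 1"
    "AE y in lebesgue. g y = \<bar>f y\<bar> / Lp_norm p f"
proof -
  have [measurable]: "\<Omega> \<in> sets borel" using \<open>open \<Omega>\<close> by simp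
  define I where "I = (LINT x|lebesgue. \<bar>f x\<bar> powr p)"
  have I: "0 < I" using integral_powr_pos[OF f(1,2)] by (simp add: I_def)
  define A where "A = Lp_norm p f"
  have A: "0 < A" "A powr p = I" using I p by (auto simp: A_def Lp_norm_def I_def[symmetric] powr_powr)
  obtain f' where f'[measurable]: "f' \<in> borel_measurable lborel" and "AE x in lborel. f x = f' x"
    using completion_ex_borel_measurable_real[of f lborel] f(1) by (auto simp: Lp_def)
  then have f'_eq: "AE x in lebesgue. f x = f' x" by (simp add: AE_completion_iff)
  \<comment> \<open>The indicator makes \<open>g\<close> vanish everywhere outside the domain, as
    the bound on superlevel sets requires; by the support condition this alters a null set
    only.\<close>
  define g where "g y = indicator \<Omega> y * \<bar>f' y\<bar> / A" for y
  have g_eq: "AE y in lebesgue. g y = \<bar>f y\<bar> / A"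
    using f'_eq AE_eq_0_outside_ess_support[of f]
    by eventually_elim (use f(3) in \<open>auto simp: g_def indicator_def\<close>)
  show ?thesis
  proof
    show "g \<in> borel_measurable borel" using f' unfolding g_def by simp
    show "0 \<le> g y" for y using A by (simp add: g_def)
    show "g y = 0" if "y \<notin> \<Omega>" for y using that by (simp add: g_def)
    show "AE y in lebesgue. g y = \<bar>f y\<bar> / Lp_norm p f" using g_eq by (simp add: A_def)
    have "(\<integral>\<^sup>+y. ennreal (g y powr p) \<partial>lborel) = (\<integral>\<^sup>+y. ennreal (g y powr p) \<partial>lebesgue)"
      by (simp add: nn_integral_completion)
    also have "\<dots> = (\<integral>\<^sup>+y. ennreal (1 / I * \<bar>f y\<bar> powr p) \<partial>lebesgue)"
    proof (intro nn_integral_cong_AE)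
      from g_eq show "AE y in lebesgue. ennreal (g y powr p) = ennreal (1 / I * \<bar>f y\<bar> powr p)"
        by eventually_elim (use A in \<open>simp add: powr_divide\<close>)
    qed
    also have "\<dots> = ennreal (LINT y|lebesgue. 1 / I * \<bar>f y\<bar> powr p)"
      using f(1) I by (intro nn_integral_eq_integral) (auto simp: Lp_def)
    also have "(LINT y|lebesgue. 1 / I * \<bar>f y\<bar> powr p) = 1" using I by (simp add: I_def)
    finally show "(\<integral>\<^sup>+y. ennreal (g y powr p) \<partial>lborel) \<le> 1" by simp
  qed
qed

text \<open>The triangle inequality for integrals, with \<open>n / p - n = - (n / q)\<close>. It
  supplies the hypothesis on \<open>u\<close> in the exponential estimate.\<close>

lemma riesz_potential_normalized_le:
  fixes f :: "'a::euclidean_space \<Rightarrow> real"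
  assumes p: "1 < p" and q: "q = p / (p - 1)"
    and g: "AE y in lebesgue. g y = \<bar>f y\<bar> / Lp_norm p f"
  shows "ennreal \<bar>riesz_potential (real DIM('a) / p) f x / Lp_norm p f\<bar> \<le>
    (\<integral>\<^sup>+y. ennreal (norm (x - y) powr - (real DIM('a) / q) * g y) \<partial>lborel)"
proof -
  define n where "n = real DIM('a)"
  define A where "A = Lp_norm p f"
  have A: "0 \<le> A" by (simp add: A_def Lp_norm_def)
  have "1 / q = 1 - 1 / p" using conjugate_exponent(2)[OF p q] by simp
  then have "n * (1 / q) = n * (1 - 1 / p)" by (rule arg_cong)
  then have ex: "n / p - n = - (n / q)" by (simp add: right_diff_distrib)
  have "riesz_potential (n / p) f x / A = (LINT y|lebesgue. norm (x - y) powr - (n / q) * f y / A)"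
    by (simp add: riesz_potential_def n_def[symmetric] ex)
  then have "ennreal \<bar>riesz_potential (n / p) f x / A\<bar> =
      ennreal (norm (LINT y|lebesgue. norm (x - y) powr - (n / q) * f y / A))"
    by (simp only: real_norm_def)
  also have "\<dots> \<le> (\<integral>\<^sup>+y. ennreal (norm (norm (x - y) powr - (n / q) * f y / A)) \<partial>lebesgue)"
    by (rule ennreal_norm_integral_le)
  also have "\<dots> = (\<integral>\<^sup>+y. ennreal (norm (x - y) powr - (n / q) * g y) \<partial>lebesgue)"
  proof (intro nn_integral_cong_AE)
    from g show "AE y in lebesgue. ennreal (norm (norm (x - y) powr - (n / q) * f y / A)) =
        ennreal (norm (x - y) powr - (n / q) * g y)"
      by eventually_elim (use A in \<open>simp add: abs_mult A_def\<close>)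
  qed
  also have "\<dots> = (\<integral>\<^sup>+y. ennreal (norm (x - y) powr - (n / q) * g y) \<partial>lborel)"
    by (simp add: nn_integral_completion)
  finally show ?thesis by (simp add: n_def A_def)
qed

theorem theorem1p1:
  fixes p \<alpha> :: real and \<Omega> :: "(real ^ 'n) set"
  defines "n \<equiv> CARD('n)"
  assumes "n \<ge> 2"
    and "1 < p"
    and "0 \<le> \<alpha>" and "\<alpha> < real n"
    and "open \<Omega>" and "emeasure lebesgue \<Omega> < \<infinity>"
  shows "\<exists>c0::real. \<forall>f\<in>Lp p. \<not> (AE x in lebesgue. f x = 0) \<longrightarrow> ess_support f \<subseteq> \<Omega> \<longrightarrow>
    (\<integral>\<^sup>+ x\<in>\<Omega>. ennreal
        (exp ((1 - \<alpha> / real n) * (real n / unit_sphere_area n)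
            * \<bar>riesz_potential (real n / p) f x / Lp_norm p f\<bar> powr (p / (p - 1)))
          / norm x powr \<alpha>) \<partial>lebesgue) \<le> ennreal c0"
proof -
  note p = \<open>1 < p\<close>
  have p0: "0 < p" using p by simp
  define q where "q = p / (p - 1)"
  have dim: "real n = real DIM(real ^ 'n)" by (simp add: n_def)
  have n: "0 < real n" using \<open>n \<ge> 2\<close> by simp
  define v where "v = unit_ball_vol (real n)"
  define d where "d = 1 - \<alpha> / real n"
  have d: "0 < d" using \<open>\<alpha> < real n\<close> n by (simp add: d_def)
  have \<Omega>_borel: "\<Omega> \<in> sets borel" using \<open>open \<Omega>\<close> by simp
  then have "emeasure lborel \<Omega> < \<infinity>" using \<open>emeasure lebesgue \<Omega> < \<infinity>\<close> by simp
  then obtain V where V: "emeasure lborel \<Omega> = ennreal V" "0 \<le> V" by (cases "emeasure lborel \<Omega>") auto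
  have area: "real n / unit_sphere_area n = 1 / v"
    using \<open>n \<ge> 2\<close> by (simp add: unit_sphere_area_eq v_def)
  \<comment> \<open>The layers need \<open>V > 0\<close>; an open set of measure 0 is empty.\<close>
  show ?thesis
  proof (cases "V = 0")
    case True
    then have "\<Omega> = {}" using V \<open>open \<Omega>\<close> open_not_negligible[of \<Omega>] \<Omega>_borel
      by (auto simp: negligible_iff_null_sets null_sets_def)
    then show ?thesis by auto
  next
    case False
    then have Vpos: "0 < V" using V by simp
    \<comment> \<open>\<open>C\<close> is obtained from \<open>p\<close> and \<open>d\<close> alone,
      before \<open>f\<close> is fixed, so that the final constant is uniform in
      \<open>f\<close>.\<close>
    obtain C where C: "\<And>P. decseq P \<Longrightarrow> (\<And>k. 0 \<le> P k) \<Longrightarrow> P 0 \<le> 1 \<Longrightarrow>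
        (\<Sum>k. ennreal (exp (d * (adams_bound p P k powr q - real k)))) \<le> ennreal C"
      using adams_discrete[OF p q_def d] by blast
    define c where "c = v powr (\<alpha> / real n) / d * V powr d * exp d"
    have c0: "0 \<le> c" using d by (simp add: c_def)
    show ?thesis
    proof (intro exI[of _ "c * C"] ballI impI)
      fix f :: "real ^ 'n \<Rightarrow> real"
      assume f: "f \<in> Lp p" "\<not> (AE x in lebesgue. f x = 0)" "ess_support f \<subseteq> \<Omega>"
      obtain g where g: "g \<in> borel_measurable borel" "\<And>y. 0 \<le> g y" "\<And>y. y \<notin> \<Omega> \<Longrightarrow> g y = 0"
        "(\<integral>\<^sup>+y. ennreal (g y powr p) \<partial>lborel) \<le> 1"
        and g_eq: "AE y in lebesgue. g y = \<bar>f y\<bar> / Lp_norm p f"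
        using normalized_representative[OF p0 f \<open>open \<Omega>\<close>] by blast
      have super: "emeasure lborel {y. \<tau> < g y} \<le> ennreal V" if "0 < \<tau>" for \<tau>
        unfolding V(1)[symmetric] using that g(3) \<Omega>_borel by (intro emeasure_mono) force+
      note ctx = g(1,2) p g(4) Vpos super
      have "(\<Sum>k. ennreal (exp (d * (adams_bound p (layer_mass p V g) k powr q - real k)))) \<le> ennreal C"
        using layer_mass_le_1[OF ctx] layer_mass_Suc_le[OF ctx] layer_mass_nonneg
        by (intro C) (auto simp: decseq_Suc_iff)
      note bound = nn_integral_exp_riesz_le[OF ctx q_def \<Omega>_borel V(1) \<open>0 \<le> \<alpha>\<close> _ _ this[unfolded d_def dim],
          folded dim, folded v_def d_def, folded c_def]
      have "(\<integral>\<^sup>+x\<in>\<Omega>. ennreal (exp (d / v * \<bar>riesz_potential (real n / p) f x / Lp_norm p f\<bar> powr q)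
          / norm x powr \<alpha>) \<partial>lborel) \<le> ennreal c * ennreal C"
        by (rule bound[OF _ \<open>\<alpha> < real n\<close> riesz_potential_normalized_le[OF p q_def g_eq, folded dim]])
      then show "(\<integral>\<^sup>+ x\<in>\<Omega>. ennreal
        (exp ((1 - \<alpha> / real n) * (real n / unit_sphere_area n)
            * \<bar>riesz_potential (real n / p) f x / Lp_norm p f\<bar> powr (p / (p - 1)))
          / norm x powr \<alpha>) \<partial>lebesgue) \<le> ennreal (c * C)"
        using c0 by (simp only: area nn_integral_completion d_def[symmetric] q_def[symmetric] ennreal_mult' mult_1_right times_divide_eq_right)
    qed
  qed
qed

end
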